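(* Let $Y=X\beta^\star+\xi$ with $\xi\sim\mathcal N_n(0,\Sigma)$. Assume that the variance-covariance matrix $\Sigma$ is $\sigma^2\mathrm{Id}_n$, where $\sigma>0$ is unknown, and that for all $i\neq j\in\{1,\dots,p\}$ one has $\|X_i\|_2=1$, $X_i\neq X_j$, and $X_{-i}$ has rank $n$. Then, under the null hypothesis $\mathbb H_0:\ \beta^\star\in\ker(X)$, the statistic $T$ is uniformly distributed on $[0,1]$.
   Context: $X\in\mathbb R^{n\times p}$ is a design matrix with columns $X_1,\dots,X_p$, and $\beta^\star\in\mathbb R^p$. For $i\in\{1,\dots,p\}$, $X_{-i}\in\mathbb R^{n\times(p-1)}$ denotes $X$ with its $i$-th column deleted. Definition of $T$ (the output of the t-Spacing test for LARS). Set $U:=X^\top Y$ and $R:=X^\top X$. Let $(\hat\imath,\hat\varepsilon)\in\{1,\dots,p\}\times\{\pm1\}$ be the (almost surely unique) pair with $\hat\varepsilon U_{\hat\imath}=\|U\|_\infty$; set $\lambda_1:=\hat\varepsilon U_{\hat\imath}$ and $$\lambda_2:=\max_{1\le j\le p,\ j\neq\hat\imath}\ \max\Big\{\frac{U_j-R_{j\hat\imath}U_{\hat\imath}}{1-\hat\varepsilon R_{j\hat\imath}},\ \frac{-U_j+R_{j\hat\imath}U_{\hat\imath}}{1+\hat\varepsilon R_{j\hat\imath}}\Big\}.$$ For $i\in\{1,\dots,p\}$ set $R_{-i}:=X_{-i}^\top(\mathrm{Id}_n-X_iX_i^\top)X_{-i}$, let $R_{-i}^{-1/2}$ be the (symmetric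 positive semidefinite) square root of the Moore–Penrose pseudoinverse of $R_{-i}$, and let $V_{-i}\in\mathbb R^{p-1}$ be the vector with entries $U_j-R_{ji}U_i$, $j\ne i$, in increasing order of $j$. Set $$\hat\sigma:=\frac{\|R_{-\hat\imath}^{-1/2}V_{-\hat\imath}\|_2}{\sqrt{n-1}},\qquad T_1:=\frac{\lambda_1}{\hat\sigma},\qquad T_2:=\frac{\lambda_2}{\hat\sigma},\qquad T:=\frac{1-\mathbb F_{n-1}(T_1)}{1-\mathbb F_{n-1}(T_2)},$$ where $\mathbb F_{n-1}$ is the cumulative distribution function of Student's $t$-distribution with $n-1$ degrees of freedom. *)

theory Defs
  imports "HOL-Probability.Probability" "Jordan_Normal_Form.DL_Rank"
    "Jordan_Normal_Form.Matrix_Kernel"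
begin

unbundle no vec_syntax
unbundle no inner_syntax

definition l2_norm :: "real vec \<Rightarrow> real" where
  "l2_norm v = sqrt (v \<bullet> v)"

definition linf_norm :: "real vec \<Rightarrow> real" where
  "linf_norm v = Max ((\<lambda>j. \<bar>v $ j\<bar>) ` {..<dim_vec v})"

text \<open>\<^term>\<open>insert_index i\<close> is the increasing enumeration of all indices other than \<open>i\<close>.\<close>

definition del_col :: "'a mat \<Rightarrow> nat \<Rightarrow> 'a mat" where
  "del_col A i = mat (dim_row A) (dim_col A - 1) (\<lambda>(r, k). A $$ (r, insert_index i k))"

text \<open>The Moore--Penrose pseudoinverse, given by the four Penrose equations.\<close>

definition pinv :: "real mat \<Rightarrow> real mat" where
  "pinv A = (THE B. B \<in> carrier_mat (dim_col A) (dim_row A) \<and>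
     A * B * A = A \<and> B * A * B = B \<and>
     transpose_mat (A * B) = A * B \<and> transpose_mat (B * A) = B * A)"

definition psd_mat :: "real mat \<Rightarrow> bool" where
  "psd_mat A \<longleftrightarrow> square_mat A \<and> transpose_mat A = A \<and>
     (\<forall>v\<in>carrier_vec (dim_col A). 0 \<le> v \<bullet> (A *\<^sub>v v))"

definition psd_sqrt :: "real mat \<Rightarrow> real mat" where
  "psd_sqrt A = (THE S. S \<in> carrier_mat (dim_row A) (dim_col A) \<and> psd_mat S \<and> S * S = A)"

text \<open>
  \<open>\<xi>\<close> has law \<open>N\<^sub>n(\<mu>, \<Sigma>)\<close> if it is distributed as \<open>\<mu> + A Z\<close>, where \<open>A A\<^sup>T = \<Sigma>\<close> and the
  coordinates of \<open>Z\<close> are independent standard normal variables. Laws of random vectors of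
  type \<^typ>\<open>real vec\<close> are compared through their coordinate functions in the product
  Borel space over \<open>{..<n}\<close>.
\<close>

definition coords :: "nat \<Rightarrow> real vec \<Rightarrow> nat \<Rightarrow> real" where
  "coords n v = (\<lambda>i\<in>{..<n}. v $ i)"

definition multivariate_normal ::
    "'a measure \<Rightarrow> nat \<Rightarrow> ('a \<Rightarrow> real vec) \<Rightarrow> real vec \<Rightarrow> real mat \<Rightarrow> bool" where
  "multivariate_normal M n \<xi> \<mu> \<Sigma> \<longleftrightarrow>
     \<mu> \<in> carrier_vec n \<and>
     (\<forall>\<omega>\<in>space M. \<xi> \<omega> \<in> carrier_vec n) \<and>
     (\<lambda>\<omega>. coords n (\<xi> \<omega>)) \<in> measurable M (Pi\<^sub>M {..<n} (\<lambda>_. borel)) \<and>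
     (\<exists>A\<in>carrier_mat n n. A * transpose_mat A = \<Sigma> \<and>
        distr M (Pi\<^sub>M {..<n} (\<lambda>_. borel)) (\<lambda>\<omega>. coords n (\<xi> \<omega>)) =
        distr (Pi\<^sub>M {..<n} (\<lambda>_. std_normal_distribution)) (Pi\<^sub>M {..<n} (\<lambda>_. borel))
          (\<lambda>z. coords n (\<mu> + A *\<^sub>v vec n z)))"

definition student_density :: "real \<Rightarrow> real \<Rightarrow> real" where
  "student_density \<nu> x = Gamma ((\<nu> + 1) / 2) / (sqrt (\<nu> * pi) * Gamma (\<nu> / 2)) *
     (1 + x\<^sup>2 / \<nu>) powr (- ((\<nu> + 1) / 2))"

definition student_cdf :: "real \<Rightarrow> real \<Rightarrow> real" where
  "student_cdf \<nu> = cdf (density lborel (\<lambda>x. ennreal (student_density \<nu> x)))"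

text \<open>
  The statistics below are functions of the design \<open>X\<close> (with \<open>n = dim_row X\<close> rows and
  \<open>p = dim_col X\<close> columns, indexed from 0) and of the observed response \<open>y\<close>.
\<close>

definition corr :: "real mat \<Rightarrow> real vec \<Rightarrow> real vec" where
  "corr X y = transpose_mat X *\<^sub>v y"

definition gram :: "real mat \<Rightarrow> real mat" where
  "gram X = transpose_mat X * X"

text \<open>
  The maximising pair is only almost surely unique, hence \<open>SOME\<close>. If \<open>X\<close> has antipodal columns
  \<open>X\<^sub>j = - X\<^sub>i\<close>, the pairs \<open>(i, \<epsilon>)\<close> and \<open>(j, - \<epsilon>)\<close> tie, and one of the two quotients in
  \<open>lars_knot2\<close> for that \<open>j\<close> is \<open>0 / 0 = 0\<close>. All other quantities are the same for both pairs and
  \<open>lars_knot2\<close> is nonnegative in any case, so the statistic does not depend on the choice.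
\<close>

definition lars_first :: "real mat \<Rightarrow> real vec \<Rightarrow> nat \<times> real" where
  "lars_first X y = (SOME (i, \<epsilon>). i < dim_col X \<and> \<epsilon> \<in> {- 1, 1} \<and>
     \<epsilon> * corr X y $ i = linf_norm (corr X y))"

definition lars_knot1 :: "real mat \<Rightarrow> real vec \<Rightarrow> real" where
  "lars_knot1 X y = (let (i, \<epsilon>) = lars_first X y in \<epsilon> * corr X y $ i)"

definition lars_knot2 :: "real mat \<Rightarrow> real vec \<Rightarrow> real" where
  "lars_knot2 X y =
     (let (i, \<epsilon>) = lars_first X y; U = corr X y; R = gram X
      in Max ((\<lambda>j. max ((U $ j - R $$ (j, i) * U $ i) / (1 - \<epsilon> * R $$ (j, i)))
                       ((- U $ j + R $$ (j, i) * U $ i) / (1 + \<epsilon> * R $$ (j, i))))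
              ` ({..<dim_col X} - {i})))"

definition residual_gram :: "real mat \<Rightarrow> nat \<Rightarrow> real mat" where
  "residual_gram X i =
     (let n = dim_row X; C = mat_of_cols n [col X i]
      in transpose_mat (del_col X i) * (1\<^sub>m n - C * transpose_mat C) * del_col X i)"

definition residual_corr :: "real mat \<Rightarrow> real vec \<Rightarrow> nat \<Rightarrow> real vec" where
  "residual_corr X y i =
     vec (dim_col X - 1) (\<lambda>k. let j = insert_index i k
       in corr X y $ j - gram X $$ (j, i) * corr X y $ i)"

definition sigma_hat :: "real mat \<Rightarrow> real vec \<Rightarrow> real" where
  "sigma_hat X y =
     (let i = fst (lars_first X y)
      in l2_norm (psd_sqrt (pinv (residual_gram X i)) *\<^sub>v residual_corr X y i)
         / sqrt (real (dim_row X) - 1))"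

definition t_spacing :: "real mat \<Rightarrow> real vec \<Rightarrow> real" where
  "t_spacing X y =
     (let F = student_cdf (real (dim_row X) - 1);
          T\<^sub>1 = lars_knot1 X y / sigma_hat X y;
          T\<^sub>2 = lars_knot2 X y / sigma_hat X y
      in (1 - F T\<^sub>1) / (1 - F T\<^sub>2))"

end

theory Submission
  imports Defs "Jordan_Normal_Form.Spectral_Radius"
begin

text \<open>
  Under the null hypothesis \<open>Y = \<xi> = A z\<close> with \<open>z\<close> standard normal and \<open>A A\<^sup>T = \<sigma>\<^sup>2 I\<close>. Let \<open>V\<close> be the
  finite set of unit vectors \<open>\<plusminus> A\<^sup>T X\<^sub>i / \<sigma>\<close>. The signed correlations are \<open>\<sigma> (v \<bullet> z)\<close> for \<open>v \<in> V\<close>, so the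
  first knot selects the \<open>w \<in> V\<close> that maximises \<open>v \<bullet> z\<close>. Write \<open>q\<close> for the component of \<open>z\<close> orthogonal to
  \<open>w\<close> and \<open>\<nu> = n - 1\<close>. Three facts make the statistic uniform.

  First, because the remaining columns span the whole space, the noise estimate is just
  \<open>\<sigma> |q| / sqrt \<nu>\<close> (\<open>residual_norm\<close>). This is where the pseudoinverse and its square root have to
  be understood, and their existence and uniqueness rest on the spectral theorem.

  Second, the second knot is \<open>\<sigma> L\<close>, where \<open>L\<close> depends on \<open>q\<close> only and is homogeneous of degree 1, and \<open>w\<close>
  is the selected direction exactly if \<open>w \<bullet> z > L\<close> (\<open>runner_up\<close>, \<open>spacing_uniform\<close>). So the second
  ratio \<open>T\<^sub>2 = L sqrt \<nu> / |q|\<close> is a function of the direction of \<open>q\<close>.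

  Third, \<open>T\<^sub>1 = (w \<bullet> z) sqrt \<nu> / |q|\<close> has Student's distribution with \<open>\<nu>\<close> degrees of freedom and is
  independent of the direction of \<open>q\<close>. Given this direction and the event \<open>T\<^sub>1 > T\<^sub>2\<close> that \<open>w\<close> is selected,
  the ratio of the Student tails at \<open>T\<^sub>1\<close> and at \<open>T\<^sub>2\<close> is therefore uniform
  (\<open>truncated_student_uniform\<close>). Summing over \<open>w\<close>, and noting that ties are null events, gives the
  theorem.

  The third fact takes the form of the integral formula \<open>gauss_polar\<close>. It comes from two symmetries
  of Lebesgue measure: translation invariance, by which an integral over the space can be computed
  along the lines in direction \<open>w\<close> (\<open>nn_integral_along_lines\<close>), and the behaviour under dilations, which
  separates the \<open>t\<close>-ratio from the direction of \<open>q\<close>.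
\<close>

section \<open>Spectral theorem for real symmetric matrices\<close>

lemma symmetric_mat_scalar_prod:
  fixes A :: "'a::comm_semiring_0 mat"
  assumes "A \<in> carrier_mat n n" "transpose_mat A = A" "x \<in> carrier_vec n" "y \<in> carrier_vec n"
  shows "(A *\<^sub>v y) \<bullet> x = y \<bullet> (A *\<^sub>v x)"
  using transpose_vec_mult_scalar[of A n n x y] assms by simp

text \<open>
  Over \<open>\<complex>\<close> an eigenvector \<open>a + i b\<close> always exists. Symmetry, applied to the pair \<open>a\<close>, \<open>b\<close>,
  forces the imaginary part of its eigenvalue to vanish, so the real and imaginary parts \<open>a\<close>, \<open>b\<close>
  satisfy the real eigenvalue equation and one of them is nonzero.
\<close>

lemma symmetric_real_eigenvector:
  fixes A :: "real mat"
  assumes A: "A \<in> carrier_mat n n" and sym: "transpose_mat A = A" and n: "n > 0"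
  obtains e v where "v \<in> carrier_vec n" "v \<bullet> v = 1" "A *\<^sub>v v = e \<cdot>\<^sub>v v"
proof -
  let ?C = "map_mat complex_of_real A"
  have C: "?C \<in> carrier_mat n n" and symC: "transpose_mat ?C = ?C"
    using A sym by (auto simp: map_mat_transpose)
  obtain l where "eigenvalue ?C l"
    using spectrum_non_empty[OF C] n by (auto simp: spectrum_def)
  then obtain w where "eigenvector ?C w l"
    unfolding eigenvalue_def by blast
  then have w: "w \<in> carrier_vec n" "w \<noteq> 0\<^sub>v n" "?C *\<^sub>v w = l \<cdot>\<^sub>v w"
    using C by (auto simp: eigenvector_def)
  define a b where "a = map_vec Re w" and "b = map_vec Im w"
  have ab: "a \<in> carrier_vec n" "b \<in> carrier_vec n"
    using w by (auto simp: a_def b_def)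
  have comp: "(\<Sum>k<n. complex_of_real (A $$ (i, k)) * w $ k) = l * w $ i" if "i < n" for i
  proof -
    show ?thesis
      using arg_cong[OF w(3), of "\<lambda>x. x $ i"] that A w(1) by (simp add: scalar_prod_def lessThan_atLeast0)
  qed
  have Aa: "A *\<^sub>v a = Re l \<cdot>\<^sub>v a - Im l \<cdot>\<^sub>v b"
  proof (rule eq_vecI)
    fix i assume "i < dim_vec (Re l \<cdot>\<^sub>v a - Im l \<cdot>\<^sub>v b)"
    then have i: "i < n" using ab by simp
    show "(A *\<^sub>v a) $ i = (Re l \<cdot>\<^sub>v a - Im l \<cdot>\<^sub>v b) $ i"
      using arg_cong[OF comp[OF i], of Re] i A w
      by (simp add: scalar_prod_def lessThan_atLeast0 a_def b_def)
  qed (use A ab in simp)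
  have Ab: "A *\<^sub>v b = Im l \<cdot>\<^sub>v a + Re l \<cdot>\<^sub>v b"
  proof (rule eq_vecI)
    fix i assume "i < dim_vec (Im l \<cdot>\<^sub>v a + Re l \<cdot>\<^sub>v b)"
    then have i: "i < n" using ab by simp
    show "(A *\<^sub>v b) $ i = (Im l \<cdot>\<^sub>v a + Re l \<cdot>\<^sub>v b) $ i"
      using arg_cong[OF comp[OF i], of Im] i A w
      by (simp add: scalar_prod_def lessThan_atLeast0 a_def b_def)
  qed (use A ab in simp)
  have "(A *\<^sub>v a) \<bullet> b = a \<bullet> (A *\<^sub>v b)"
    by (rule symmetric_mat_scalar_prod[OF A sym ab(2) ab(1)])
  then have "Im l * (a \<bullet> a + b \<bullet> b) = 0"
    using ab by (simp add: Aa Ab minus_scalar_prod_distrib[of _ n] scalar_prod_add_distrib[of _ n]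
        algebra_simps)
  moreover have pos: "a \<bullet> a + b \<bullet> b \<noteq> 0"
  proof
    assume "a \<bullet> a + b \<bullet> b = 0"
    moreover have "a \<bullet> a \<ge> 0" "b \<bullet> b \<ge> 0"
      by (auto simp: scalar_prod_def intro!: sum_nonneg)
    ultimately have "a \<bullet> a = 0" "b \<bullet> b = 0" by linarith+
    then have "a = 0\<^sub>v n" "b = 0\<^sub>v n"
      using ab conjugate_square_eq_0_vec[of a n] conjugate_square_eq_0_vec[of b n]
      by (auto simp: conjugate_vec_def)
    then have "w = 0\<^sub>v n"
      using w by (intro eq_vecI) (auto simp: a_def b_def complex_eq_iff vec_eq_iff)
    with w show False by simp
  qed
  ultimately have "Im l = 0" by simp
  then have ev: "A *\<^sub>v a = Re l \<cdot>\<^sub>v a" "A *\<^sub>v b = Re l \<cdot>\<^sub>v b"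
    using Aa Ab ab by auto
  obtain c where c: "c \<in> carrier_vec n" "A *\<^sub>v c = Re l \<cdot>\<^sub>v c" "c \<bullet> c \<noteq> 0"
    using pos ev ab by (metis add.right_neutral)
  have "c \<bullet> c \<ge> 0" by (auto simp: scalar_prod_def intro!: sum_nonneg)
  then have cc: "c \<bullet> c > 0" using c by simp
  show thesis
  proof (rule that[of "(1 / sqrt (c \<bullet> c)) \<cdot>\<^sub>v c" "Re l"])
    show "((1 / sqrt (c \<bullet> c)) \<cdot>\<^sub>v c) \<bullet> ((1 / sqrt (c \<bullet> c)) \<cdot>\<^sub>v c) = 1"
      using c(1) cc by simp
    show "A *\<^sub>v ((1 / sqrt (c \<bullet> c)) \<cdot>\<^sub>v c) = Re l \<cdot>\<^sub>v ((1 / sqrt (c \<bullet> c)) \<cdot>\<^sub>v c)"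
      using c A by (simp add: mult_mat_vec smult_smult_assoc mult.commute)
  qed (use c in simp)
qed

text \<open>
  The reflection in the hyperplane orthogonal to \<open>u = v - e\<^sub>0\<close> exchanges \<open>v\<close> and \<open>e\<^sub>0\<close>. It serves to
  move an eigenvector onto the first axis by an orthogonal and symmetric matrix.
\<close>

lemma householder_reflection:
  fixes v :: "real vec"
  assumes v: "v \<in> carrier_vec n" "v \<bullet> v = 1" and n: "n > 0"
  obtains H where "H \<in> carrier_mat n n" "transpose_mat H = H" "H * H = 1\<^sub>m n"
    "H *\<^sub>v unit_vec n 0 = v"
proof (cases "v = unit_vec n 0")
  case True
  show ?thesis by (rule that[of "1\<^sub>m n"]) (auto simp: True)
next
  case False
  define u where "u = (\<lambda>i. v $ i - (if i = 0 then 1 else 0))"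
  have vv: "(\<Sum>k<n. v $ k * v $ k) = 1"
    using v by (simp add: scalar_prod_def lessThan_atLeast0)
  have "(\<Sum>k<n. u k * u k) = (\<Sum>k<n. v $ k * v $ k - (if k = 0 then 2 * v $ 0 - 1 else 0))"
    by (intro sum.cong) (auto simp: u_def algebra_simps)
  then have uu: "(\<Sum>k<n. u k * u k) = 2 - 2 * v $ 0"
    using n by (simp add: sum_subtractf vv)
  \<comment> \<open>Otherwise \<open>v = e\<^sub>0\<close>, which the first case covers.\<close>
  have nz: "(\<Sum>k<n. u k * u k) \<noteq> 0"
  proof
    assume "(\<Sum>k<n. u k * u k) = 0"
    then have "\<forall>k<n. u k = 0"
      by (subst (asm) sum_nonneg_eq_0_iff) auto
    then have "v = unit_vec n 0"
      using v by (intro eq_vecI) (auto simp: u_def unit_vec_def)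
    with False show False by simp
  qed
  define c where "c = 2 / (\<Sum>k<n. u k * u k)"
  define H where "H = mat n n (\<lambda>(i, j). (if i = j then 1 else 0) - c * u i * u j)"
  have H: "H \<in> carrier_mat n n" by (simp add: H_def)
  have cu: "c * u 0 = -1"
    using nz unfolding c_def uu by (simp add: u_def field_simps)
  show ?thesis
  proof (rule that[OF H])
    show "transpose_mat H = H" by (auto simp: H_def)
    show "H * H = 1\<^sub>m n"
    proof (rule eq_matI)
      fix i j assume "i < dim_row (1\<^sub>m n :: real mat)" "j < dim_col (1\<^sub>m n :: real mat)"
      then have ij: "i < n" "j < n" by simp_all
      have "(H * H) $$ (i, j) = (\<Sum>k<n. ((if i = k then 1 else 0) - c * u i * u k) *
               ((if k = j then 1 else 0) - c * u k * u j))"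
        using ij by (simp add: H_def scalar_prod_def lessThan_atLeast0)
      also have "\<dots> = (\<Sum>k<n. (if k = i then (if i = j then 1 else 0) - c * u i * u j else 0)
               - (if k = j then c * u i * u j else 0) + c * c * u i * u j * (u k * u k))"
        by (intro sum.cong) (auto simp: algebra_simps)
      also have "\<dots> = (if i = j then 1 else 0) - 2 * c * u i * u j
               + c * c * u i * u j * (\<Sum>k<n. u k * u k)"
        using ij by (simp add: sum.distrib sum_subtractf sum_distrib_left)
      also have "\<dots> = (if i = j then 1 else 0)"
        using nz by (simp add: c_def)
      finally show "(H * H) $$ (i, j) = 1\<^sub>m n $$ (i, j)" using ij by simp
    qed (use H in auto)
    show "H *\<^sub>v unit_vec n 0 = v"
    proof (rule eq_vecI)
      fix i assume "i < dim_vec v"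
      then have i: "i < n" using v by simp
      have "(H *\<^sub>v unit_vec n 0) $ i = (if i = 0 then 1 else 0) - c * u i * u 0"
        using i n H by (simp add: H_def)
      also have "\<dots> = (if i = 0 then 1 else 0) + u i"
        using cu by (metis (no_types) diff_minus_eq_add mult.assoc mult.commute mult_minus1)
      also have "\<dots> = v $ i" by (simp add: u_def)
      finally show "(H *\<^sub>v unit_vec n 0) $ i = v $ i" .
    qed (use v H in auto)
  qed
qed

text \<open>
  Induction on the dimension: a Householder reflection moves a unit eigenvector onto the first axis,
  after which symmetry makes the conjugated matrix block diagonal with a smaller symmetric block.
\<close>

theorem spectral_theorem_real:
  fixes A :: "real mat"
  assumes "A \<in> carrier_mat n n" "transpose_mat A = A"
  shows "\<exists>P d. P \<in> carrier_mat n n \<and> transpose_mat P * P = 1\<^sub>m n \<and> P * transpose_mat P = 1\<^sub>m n \<and>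
           A = P * mat_diag n d * transpose_mat P"
  using assms
proof (induction n arbitrary: A)
  case 0
  then show ?case by (intro exI[of _ "1\<^sub>m 0"] exI[of _ "\<lambda>_. 0"] conjI eq_matI) auto
next
  case (Suc n)
  note A = Suc.prems(1) and sym = Suc.prems(2)
  obtain e v where v: "v \<in> carrier_vec (Suc n)" "v \<bullet> v = 1" "A *\<^sub>v v = e \<cdot>\<^sub>v v"
    using symmetric_real_eigenvector[OF A sym] by blast
  obtain H where H: "H \<in> carrier_mat (Suc n) (Suc n)" and symH: "transpose_mat H = H"
    and HH: "H * H = 1\<^sub>m (Suc n)" and Hv: "H *\<^sub>v unit_vec (Suc n) 0 = v"
    using householder_reflection[OF v(1,2)] by blast
  define B where "B = H * A * H"
  have B: "B \<in> carrier_mat (Suc n) (Suc n)" using H A by (simp add: B_def)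
  have symB: "transpose_mat B = B"
  proof -
    have "transpose_mat B = transpose_mat H * (transpose_mat A * transpose_mat H)"
      unfolding B_def using H A
      by (subst transpose_mult[of _ "Suc n" "Suc n" _ "Suc n"]; (subst transpose_mult[of _ "Suc n" "Suc n" _ "Suc n"])?) auto
    then show ?thesis
      using H A by (simp add: B_def sym symH assoc_mult_mat[of _ "Suc n" "Suc n" _ "Suc n" _ "Suc n"])
  qed
  have Hv': "H *\<^sub>v v = unit_vec (Suc n) 0"
  proof -
    have "H *\<^sub>v v = (H * H) *\<^sub>v unit_vec (Suc n) 0"
      by (simp add: Hv[symmetric] assoc_mult_mat_vec[OF H H])
    then show ?thesis by (simp add: HH)
  qed
  have Be: "B *\<^sub>v unit_vec (Suc n) 0 = e \<cdot>\<^sub>v unit_vec (Suc n) 0"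
  proof -
    have "B *\<^sub>v unit_vec (Suc n) 0 = H *\<^sub>v (A *\<^sub>v (H *\<^sub>v unit_vec (Suc n) 0))"
      unfolding B_def using H A
      by (simp add: assoc_mult_mat_vec[of _ "Suc n" "Suc n" _ "Suc n"])
    also have "\<dots> = e \<cdot>\<^sub>v unit_vec (Suc n) 0"
      unfolding Hv v(3) using H v(1) by (simp add: mult_mat_vec Hv')
    finally show ?thesis .
  qed
  have B0: "B $$ (i, 0) = (if i = 0 then e else 0)" if "i < Suc n" for i
    using arg_cong[OF Be, of "\<lambda>x. x $ i"] that B by simp
  have B0': "B $$ (0, i) = (if i = 0 then e else 0)" if "i < Suc n" for i
    using B0[OF that] arg_cong[OF symB, of "\<lambda>M. M $$ (0, i)"] that B by simp
  define D where "D = mat n n (\<lambda>(i, j). B $$ (Suc i, Suc j))"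
  have D: "D \<in> carrier_mat n n" by (simp add: D_def)
  have symD: "transpose_mat D = D"
  proof (rule eq_matI)
    fix i j assume "i < dim_row D" "j < dim_col D"
    then show "transpose_mat D $$ (i, j) = D $$ (i, j)"
      using arg_cong[OF symB, of "\<lambda>M. M $$ (Suc i, Suc j)"] B by (simp add: D_def)
  qed (auto simp: D_def)
  obtain Q d where Q: "Q \<in> carrier_mat n n" "transpose_mat Q * Q = 1\<^sub>m n" "Q * transpose_mat Q = 1\<^sub>m n"
    and DQ: "D = Q * mat_diag n d * transpose_mat Q"
    using Suc.IH[OF D symD] by blast
  let ?blk = "\<lambda>x M. four_block_mat (mat 1 1 (\<lambda>_. x)) (0\<^sub>m 1 n) (0\<^sub>m n 1) M"
  have one: "(1\<^sub>m (Suc n) :: real mat) = ?blk 1 (1\<^sub>m n)"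
    by (rule eq_matI) (auto simp: less_Suc_eq_0_disj)
  have blk_mult: "?blk x M * ?blk y N = ?blk (x * y) (M * N)"
    if "M \<in> carrier_mat n n" "N \<in> carrier_mat n n" for x y :: real and M N
    using that
    by (subst mult_four_block_mat[of _ 1 1 _ n _ n _ _ 1 _ n])
      (auto intro!: cong_four_block_mat simp: scalar_prod_def)
  have blk_carrier: "?blk x M \<in> carrier_mat (Suc n) (Suc n)" if "M \<in> carrier_mat n n" for x :: real and M
    using that by (metis four_block_carrier_mat mat_carrier plus_1_eq_Suc)
  have blk_transpose: "transpose_mat (?blk x M) = ?blk x (transpose_mat M)"
    if "M \<in> carrier_mat n n" for x :: real and M
    using that by (subst transpose_four_block_mat[of _ 1 1 _ n _ n]) (auto intro!: cong_four_block_mat)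
  have Bblk: "B = ?blk e D"
  proof (rule eq_matI)
    fix i j assume "i < dim_row (?blk e D)" "j < dim_col (?blk e D)"
    then have "i < Suc n" "j < Suc n" using D by auto
    then show "B $$ (i, j) = ?blk e D $$ (i, j)"
      using D B0[of i] B0'[of j] by (cases i; cases j) (auto simp: D_def)
  qed (use B D in auto)
  define d' where "d' = (\<lambda>i. case i of 0 \<Rightarrow> e | Suc i \<Rightarrow> d i)"
  have diag: "mat_diag (Suc n) d' = ?blk e (mat_diag n d)"
    by (rule eq_matI) (auto simp: mat_diag_def d'_def less_Suc_eq_0_disj)
  have QT: "transpose_mat Q \<in> carrier_mat n n" using Q by simp
  define K where "K = ?blk 1 Q"
  have K: "K \<in> carrier_mat (Suc n) (Suc n)" "transpose_mat K = ?blk 1 (transpose_mat Q)"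
    unfolding K_def by (rule blk_carrier[OF Q(1)], rule blk_transpose[OF Q(1)])
  have KK: "transpose_mat K * K = 1\<^sub>m (Suc n)" "K * transpose_mat K = 1\<^sub>m (Suc n)"
    unfolding K(2) unfolding K_def blk_mult[OF QT Q(1)] blk_mult[OF Q(1) QT] by (simp_all add: Q one)
  have BK: "B = K * mat_diag (Suc n) d' * transpose_mat K"
    unfolding K(2) unfolding K_def diag Bblk
    by (subst blk_mult, use Q in simp, simp, subst blk_mult, use Q in simp, use Q in simp)
      (simp add: DQ)
  have AB: "A = H * B * H"
  proof -
    have "H * B * H = (H * H) * A * (H * H)"
      unfolding B_def using H A by (simp add: assoc_mult_mat[of _ "Suc n" "Suc n" _ "Suc n" _ "Suc n"])
    then show ?thesis using A by (simp add: HH)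
  qed
  have HK: "H * K \<in> carrier_mat (Suc n) (Suc n)" using H K by simp
  have tHK: "transpose_mat (H * K) = transpose_mat K * H"
    using H K symH by (simp add: transpose_mult[of _ "Suc n" "Suc n"])
  note assoc = assoc_mult_mat[of _ "Suc n" "Suc n" _ "Suc n" _ "Suc n"]
  have "transpose_mat (H * K) * (H * K) = transpose_mat K * ((H * H) * K)"
    unfolding tHK using H K(1) by (simp add: assoc)
  then have 1: "transpose_mat (H * K) * (H * K) = 1\<^sub>m (Suc n)"
    using K(1) KK by (simp add: HH)
  have "(H * K) * transpose_mat (H * K) = H * (K * transpose_mat K) * H"
    unfolding tHK using H K(1) by (simp add: assoc)
  then have 2: "(H * K) * transpose_mat (H * K) = 1\<^sub>m (Suc n)"
    using H by (simp add: KK HH)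
  have "A = (H * K) * mat_diag (Suc n) d' * transpose_mat (H * K)"
    unfolding tHK AB BK using H K(1)
    by (simp add: assoc mult_carrier_mat[of _ "Suc n" "Suc n" _ "Suc n"])
  with 1 2 HK show ?case by blast
qed

section \<open>Pseudoinverse and positive semidefinite square root\<close>

text \<open>
  If \<open>B\<close> and \<open>C\<close> both satisfy the Penrose equations, then \<open>A B = A C\<close> and \<open>B A = C A\<close> by
  transposing, whence \<open>C = C A C = C A B = B A B = B\<close>.
\<close>

lemma pinv_eqI:
  assumes A: "A \<in> carrier_mat nr nc" and B: "B \<in> carrier_mat nc nr"
    and p: "A * B * A = A" "B * A * B = B"
      "transpose_mat (A * B) = A * B" "transpose_mat (B * A) = B * A"
  shows "pinv A = B"
  unfolding pinv_def
proof (rule the_equality)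
  fix C
  assume "C \<in> carrier_mat (dim_col A) (dim_row A) \<and> A * C * A = A \<and> C * A * C = C \<and>
     transpose_mat (A * C) = A * C \<and> transpose_mat (C * A) = C * A"
  then have C: "C \<in> carrier_mat nc nr" and q: "A * C * A = A" "C * A * C = C"
    "transpose_mat (A * C) = A * C" "transpose_mat (C * A) = C * A" using A by auto
  have AB: "A * B \<in> carrier_mat nr nr" and AC: "A * C \<in> carrier_mat nr nr"
    and BA: "B * A \<in> carrier_mat nc nc" and CA: "C * A \<in> carrier_mat nc nc"
    using A B C by auto
  have move: "(A * D) * (A * E) = (A * D * A) * E" "(D * A) * (E * A) = D * (A * E * A)"
    if "D \<in> carrier_mat nc nr" "E \<in> carrier_mat nc nr" for D E
  proof -
    have c: "A * D \<in> carrier_mat nr nr" "E * A \<in> carrier_mat nc nc"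
      using A that by auto
    show "(A * D) * (A * E) = (A * D * A) * E"
      by (rule assoc_mult_mat[OF c(1) A that(2), symmetric])
    show "(D * A) * (E * A) = D * (A * E * A)"
      by (simp only: assoc_mult_mat[OF that(1) A c(2)] assoc_mult_mat[OF A that(2) A])
  qed
  have "A * C = (A * B) * (A * C)"
    by (simp only: move(1)[OF B C] p(1))
  also have "\<dots> = transpose_mat ((A * C) * (A * B))"
    using p(3) q(3) by (simp add: transpose_mult[OF AC AB])
  also have "(A * C) * (A * B) = A * B"
    by (simp only: move(1)[OF C B] q(1))
  finally have e1: "A * C = A * B" using p(3) by simp
  have "C * A = (C * A) * (B * A)"
    by (simp only: move(2)[OF C B] p(1))
  also have "\<dots> = transpose_mat ((B * A) * (C * A))"
    using p(4) q(4) by (simp add: transpose_mult[OF BA CA])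
  also have "(B * A) * (C * A) = B * A"
    by (simp only: move(2)[OF B C] q(1))
  finally have e2: "C * A = B * A" using p(4) by simp
  have "C = C * (A * C)" using q(2) A C by (simp add: assoc_mult_mat[of _ nc nr _ nc _ nr])
  also have "\<dots> = (C * A) * B" using e1 A B C by (simp add: assoc_mult_mat[of _ nc nr _ nc _ nr])
  also have "\<dots> = B" using e2 p(2) by simp
  finally show "C = B" .
qed (use assms in auto)

text \<open>
  Replacing the eigenvalues by a function of them turns pointwise products into matrix products.
  This reduces the pseudoinverse and the square root to statements about real numbers.
\<close>

lemma spectral_calculus_mult:
  fixes P :: "real mat"
  assumes P: "P \<in> carrier_mat n n" and PP: "transpose_mat P * P = 1\<^sub>m n"
  shows "(P * mat_diag n f * transpose_mat P) * (P * mat_diag n g * transpose_mat P) =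
    P * mat_diag n (\<lambda>i. f i * g i) * transpose_mat P"
proof -
  note assoc = assoc_mult_mat[of _ n n _ n _ n]
  have "(P * mat_diag n f * transpose_mat P) * (P * mat_diag n g * transpose_mat P)
     = P * (mat_diag n f * ((transpose_mat P * P) * (mat_diag n g * transpose_mat P)))"
    using P by (simp add: assoc mult_carrier_mat[of _ n n _ n])
  also have "\<dots> = P * ((mat_diag n f * mat_diag n g) * transpose_mat P)"
    unfolding PP using P
    by (simp add: assoc mult_carrier_mat[of _ n n _ n] left_mult_one_mat[of _ n n] del: mat_diag_diag)
  finally show ?thesis using P by (simp add: assoc mult_carrier_mat[of _ n n _ n])
qed

lemma spectral_calculus_transpose:
  fixes P :: "real mat"
  assumes P: "P \<in> carrier_mat n n"
  shows "transpose_mat (P * mat_diag n f * transpose_mat P) = P * mat_diag n f * transpose_mat P"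
proof -
  have "transpose_mat (mat_diag n f) = mat_diag n f"
    by (rule eq_matI) (auto simp: mat_diag_def)
  moreover have "transpose_mat ((P * mat_diag n f) * transpose_mat P)
     = P * (transpose_mat (mat_diag n f) * transpose_mat P)"
    using P by (subst transpose_mult[of _ n n _ n], simp, simp,
        subst transpose_mult[of _ n n _ n]) auto
  ultimately show ?thesis using P by (simp add: assoc_mult_mat[of _ n n _ n _ n] mult_carrier_mat[of _ n n _ n])
qed

lemma spectral_calculus_quadratic_form:
  fixes P :: "real mat"
  assumes P: "P \<in> carrier_mat n n" and v: "v \<in> carrier_vec n"
  shows "v \<bullet> ((P * mat_diag n f * transpose_mat P) *\<^sub>v v) =
    (\<Sum>i<n. f i * ((transpose_mat P *\<^sub>v v) $ i)\<^sup>2)"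
proof -
  define u where "u = transpose_mat P *\<^sub>v v"
  have u: "u \<in> carrier_vec n" using P v by (simp add: u_def)
  have "(P * mat_diag n f * transpose_mat P) *\<^sub>v v = P *\<^sub>v (mat_diag n f *\<^sub>v u)"
    unfolding u_def using P v by (simp add: assoc_mult_mat_vec[of _ n n _ n] mult_mat_vec_carrier[of _ n n] assoc_mult_mat[of _ n n _ n _ n] mult_carrier_mat[of _ n n _ n])
  then have "v \<bullet> ((P * mat_diag n f * transpose_mat P) *\<^sub>v v) = u \<bullet> (mat_diag n f *\<^sub>v u)"
    using transpose_vec_mult_scalar[OF P _ v, of "mat_diag n f *\<^sub>v u"] u
    by (simp add: u_def[symmetric] mult_mat_vec_carrier[of _ n n])
  also have "\<dots> = (\<Sum>i<n. f i * (u $ i)\<^sup>2)"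
  proof -
    have "(mat_diag n f *\<^sub>v u) $ i = f i * u $ i" if "i < n" for i
    proof -
      have "(mat_diag n f *\<^sub>v u) $ i = (\<Sum>k<n. (if i = k then f k else 0) * u $ k)"
        using that u by (simp add: mat_diag_def scalar_prod_def lessThan_atLeast0)
      also have "\<dots> = (\<Sum>k<n. if k = i then f k * u $ k else 0)"
        by (intro sum.cong) auto
      finally show ?thesis using that by simp
    qed
    then have "u \<bullet> (mat_diag n f *\<^sub>v u) = (\<Sum>i<n. u $ i * (f i * u $ i))"
      unfolding scalar_prod_def using carrier_matD[OF mat_diag_dim[of n f]]
      by (auto simp: lessThan_atLeast0 intro!: sum.cong)
    then show ?thesis by (simp add: power2_eq_square algebra_simps)
  qed
  finally show ?thesis by (simp add: u_def)
qed

lemma psd_spectral_calculus: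
  fixes P :: "real mat"
  assumes P: "P \<in> carrier_mat n n" and "\<And>i. i < n \<Longrightarrow> 0 \<le> f i"
  shows "psd_mat (P * mat_diag n f * transpose_mat P)"
  unfolding psd_mat_def
  using assms spectral_calculus_transpose[OF P, of f] spectral_calculus_quadratic_form[OF P, of _ f]
  by (auto intro!: sum_nonneg)

lemma spectral_eigenvector:
  fixes P :: "real mat"
  assumes P: "P \<in> carrier_mat n n" and PP: "transpose_mat P * P = 1\<^sub>m n" and i: "i < n"
    and A: "A = P * mat_diag n d * transpose_mat P"
  shows "col P i \<bullet> col P i = 1" "A *\<^sub>v col P i = d i \<cdot>\<^sub>v col P i"
proof -
  have "(transpose_mat P * P) $$ (i, i) = col P i \<bullet> col P i" using P i by simp
  then show "col P i \<bullet> col P i = 1" using PP i by simp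
  have c: "col P i = P *\<^sub>v unit_vec n i"
    using P i by (intro eq_vecI) auto
  have t: "transpose_mat P *\<^sub>v col P i = unit_vec n i"
    unfolding c using P PP by (simp add: assoc_mult_mat_vec[of _ n n _ n, symmetric])
  have diag: "mat_diag n d *\<^sub>v unit_vec n i = d i \<cdot>\<^sub>v unit_vec n i"
    using i by (intro eq_vecI) (auto simp: mat_diag_def unit_vec_def scalar_prod_def if_distrib cong: if_cong)
  have "A *\<^sub>v col P i = P *\<^sub>v (mat_diag n d *\<^sub>v (transpose_mat P *\<^sub>v col P i))"
    unfolding A using P i
    by (simp add: assoc_mult_mat_vec[of _ n n _ n] mult_mat_vec_carrier[of _ n n] assoc_mult_mat[of _ n n _ n _ n] mult_carrier_mat[of _ n n _ n])
  also have "\<dots> = d i \<cdot>\<^sub>v col P i"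
    unfolding t diag using P by (simp add: c mult_mat_vec)
  finally show "A *\<^sub>v col P i = d i \<cdot>\<^sub>v col P i" .
qed

text \<open>
  Let \<open>v\<close> be a unit eigenvector of the symmetric matrix \<open>S - T\<close>, with eigenvalue \<open>d\<close>. Expanding
  \<open>|S v|\<^sup>2 = |T v|\<^sup>2\<close> with \<open>S v = T v + d v\<close> gives \<open>d = 0\<close> or \<open>d = - 2 (v \<bullet> T v)\<close>. In the second case
  \<open>v \<bullet> S v = v \<bullet> T v + d = - (v \<bullet> T v)\<close>, and as both quadratic forms are nonnegative, again \<open>d = 0\<close>.
\<close>

lemma psd_square_unique:
  assumes S: "S \<in> carrier_mat n n" "psd_mat S" and T: "T \<in> carrier_mat n n" "psd_mat T"
    and ST: "S * S = T * T"
  shows "S = T"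
proof -
  have sym: "transpose_mat S = S" "transpose_mat T = T"
    using S T by (auto simp: psd_mat_def)
  have D: "S - T \<in> carrier_mat n n" using S T by auto
  have symD: "transpose_mat (S - T) = S - T"
    using S T sym by (simp add: transpose_minus[of _ n n])
  obtain P d where P: "P \<in> carrier_mat n n" and PP: "transpose_mat P * P = 1\<^sub>m n"
    and DP: "S - T = P * mat_diag n d * transpose_mat P"
    using spectral_theorem_real[OF D symD] by blast
  have "d i = 0" if i: "i < n" for i
  proof -
    define v where "v = col P i"
    have v: "v \<in> carrier_vec n" "v \<bullet> v = 1" "(S - T) *\<^sub>v v = d i \<cdot>\<^sub>v v"
      using spectral_eigenvector[OF P PP i DP] P i by (auto simp: v_def)
    define s t where "s = S *\<^sub>v v" and "t = T *\<^sub>v v"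
    have st: "s \<in> carrier_vec n" "t \<in> carrier_vec n" using S T v by (auto simp: s_def t_def)
    \<comment> \<open>Expanding \<open>s \<bullet> s = t \<bullet> t\<close> in terms of \<open>t\<close> and \<open>v\<close> constrains \<open>d i\<close>.\<close>
    have "s = t + d i \<cdot>\<^sub>v v"
    proof -
      have "s - t = d i \<cdot>\<^sub>v v"
        using v S T by (simp add: s_def t_def minus_mult_distrib_mat_vec[of _ n n])
      then have "s $ k - t $ k = d i * v $ k" if "k < n" for k
        using that st v(1) by (auto simp: vec_eq_iff)
      then show ?thesis
        using st v(1) by (intro eq_vecI) (simp_all add: algebra_simps)
    qed
    moreover have "s \<bullet> s = t \<bullet> t"
    proof -
      have "s \<bullet> s = v \<bullet> ((S * S) *\<^sub>v v)"
        unfolding s_def using S v symmetric_mat_scalar_prod[OF S(1) sym(1), of "S *\<^sub>v v" v]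
        by (simp add: assoc_mult_mat_vec[of _ n n _ n])
      also have "\<dots> = t \<bullet> t"
        unfolding t_def ST using T v symmetric_mat_scalar_prod[OF T(1) sym(2), of "T *\<^sub>v v" v]
        by (simp add: assoc_mult_mat_vec[of _ n n _ n])
      finally show ?thesis .
    qed
    ultimately have e: "2 * (d i * (v \<bullet> t)) + d i * d i = 0" and f: "v \<bullet> s = v \<bullet> t + d i"
      using st v comm_scalar_prod[of t n v]
      by (auto simp: scalar_prod_add_distrib[of _ n] add_scalar_prod_distrib[of _ n] algebra_simps)
    have "v \<bullet> s \<ge> 0" "v \<bullet> t \<ge> 0"
      using S T v by (auto simp: psd_mat_def s_def t_def)
    moreover have "d i * (2 * (v \<bullet> t) + d i) = 0" using e by (simp add: algebra_simps)
    then have "d i = 0 \<or> d i = - 2 * (v \<bullet> t)" by auto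
    ultimately show "d i = 0" using f by auto
  qed
  then have "mat_diag n d = 0\<^sub>m n n"
    by (intro eq_matI) (auto simp: mat_diag_def)
  then have "S - T = 0\<^sub>m n n" using DP P by simp
  then have "S $$ (i, j) - T $$ (i, j) = 0" if "i < n" "j < n" for i j
  proof -
    have "(S - T) $$ (i, j) = 0"
      using that unfolding \<open>S - T = 0\<^sub>m n n\<close> by simp
    then show ?thesis using that S T by simp
  qed
  then show ?thesis
    using S T by (intro eq_matI) auto
qed

lemma psd_spectral_decomposition:
  assumes A: "A \<in> carrier_mat n n" "psd_mat A"
  obtains P d where "P \<in> carrier_mat n n" "transpose_mat P * P = 1\<^sub>m n"
    "A = P * mat_diag n d * transpose_mat P" "\<And>i. i < n \<Longrightarrow> 0 \<le> d i"
proof -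
  have sym: "transpose_mat A = A" using A by (simp add: psd_mat_def)
  obtain P d where P: "P \<in> carrier_mat n n" and PP: "transpose_mat P * P = 1\<^sub>m n"
    and AP: "A = P * mat_diag n d * transpose_mat P"
    using spectral_theorem_real[OF A(1) sym] by blast
  have d: "0 \<le> d i" if i: "i < n" for i
  proof -
    have "0 \<le> col P i \<bullet> (A *\<^sub>v col P i)"
      using A P i by (auto simp: psd_mat_def)
    then show ?thesis using spectral_eigenvector[OF P PP i AP] P i by simp
  qed
  show thesis by (rule that[OF P PP AP d])
qed

lemma psd_sqrt:
  assumes A: "A \<in> carrier_mat n n" "psd_mat A"
  shows "psd_sqrt A \<in> carrier_mat n n" "psd_mat (psd_sqrt A)" "psd_sqrt A * psd_sqrt A = A"
proof -
  obtain P d where P: "P \<in> carrier_mat n n" and PP: "transpose_mat P * P = 1\<^sub>m n"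
    and AP: "A = P * mat_diag n d * transpose_mat P" and d: "\<And>i. i < n \<Longrightarrow> 0 \<le> d i"
    using psd_spectral_decomposition[OF A] by blast
  let ?S = "P * mat_diag n (\<lambda>i. sqrt (d i)) * transpose_mat P"
  have S: "?S \<in> carrier_mat n n" "psd_mat ?S"
    using P d by (auto intro!: psd_spectral_calculus)
  have "mat_diag n (\<lambda>i. sqrt (d i) * sqrt (d i)) = mat_diag n d"
    using d by (intro eq_matI) (auto simp: mat_diag_def)
  then have SS: "?S * ?S = A"
    unfolding spectral_calculus_mult[OF P PP] by (simp add: AP)
  have "psd_sqrt A = ?S"
    unfolding psd_sqrt_def
  proof (rule the_equality)
    show "?S \<in> carrier_mat (dim_row A) (dim_col A) \<and> psd_mat ?S \<and> ?S * ?S = A"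
      using A S SS by simp
    fix T assume "T \<in> carrier_mat (dim_row A) (dim_col A) \<and> psd_mat T \<and> T * T = A"
    then have T: "T \<in> carrier_mat n n" "psd_mat T" "T * T = A" using A by auto
    show "T = ?S"
      by (rule psd_square_unique[OF T(1,2) S]) (simp only: T(3) SS)
  qed
  then show "psd_sqrt A \<in> carrier_mat n n" "psd_mat (psd_sqrt A)" "psd_sqrt A * psd_sqrt A = A"
    using S SS by (simp_all only:)
qed

lemma pinv_psd:
  assumes A: "A \<in> carrier_mat n n" "psd_mat A"
  shows "pinv A \<in> carrier_mat n n" "psd_mat (pinv A)" "A * pinv A * A = A"
proof -
  obtain P d where P: "P \<in> carrier_mat n n" and PP: "transpose_mat P * P = 1\<^sub>m n"
    and AP: "A = P * mat_diag n d * transpose_mat P" and d: "\<And>i. i < n \<Longrightarrow> 0 \<le> d i"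
    using psd_spectral_decomposition[OF A] by blast
  \<comment> \<open>As \<open>inverse 0 = 0\<close>, zero eigenvalues stay zero.\<close>
  let ?B = "P * mat_diag n (\<lambda>i. inverse (d i)) * transpose_mat P"
  have B: "?B \<in> carrier_mat n n" "psd_mat ?B"
    using P d by (auto intro!: psd_spectral_calculus)
  have cancel: "x * inverse x * x = x" "inverse x * x * inverse x = inverse x" for x :: real
    by (cases "x = 0"; simp)+
  note mult = spectral_calculus_mult[OF P PP]
  have "pinv A = ?B"
    by (rule pinv_eqI[OF A(1) B(1)])
      (simp_all only: AP mult cancel spectral_calculus_transpose[OF P])
  moreover have "A * ?B * A = A"
    by (simp only: AP mult cancel)
  ultimately show "pinv A \<in> carrier_mat n n" "psd_mat (pinv A)" "A * pinv A * A = A"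
    using B by simp_all
qed

text \<open>
  A maximal independent set of columns has \<open>n\<close> elements, hence is a basis of the whole space.
\<close>

lemma vec_space_rank_full_surj:
  fixes D :: "real mat"
  assumes D: "D \<in> carrier_mat n m" and rk: "vec_space.rank n D = n" and q: "q \<in> carrier_vec n"
  shows "\<exists>c\<in>carrier_vec m. D *\<^sub>v c = q"
proof -
  interpret vec_space "TYPE(real)" n .
  have sub: "set (cols D) \<subseteq> carrier_vec n" using D cols_dim by blast
  have "lin_indpt {}" by (simp add: finite_lin_indpt2)
  then obtain S where S: "finite S" "maximal S (\<lambda>T. T \<subseteq> set (cols D) \<and> lin_indpt T)"
    using maximal_exists_superset[of "set (cols D)" "\<lambda>T. T \<subseteq> set (cols D) \<and> lin_indpt T" "{}"]
    by auto
  have li: "S \<subseteq> set (cols D)" "lin_indpt S" using S(2) by (auto simp: maximal_def)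
  have "card S = n" using rank_card_indpt[OF D S(2)] rk by simp
  then have "basis S"
    using S(1) li sub by (intro dim_li_is_basis) (auto simp: dim_is_n)
  then have "carrier_vec n \<subseteq> span (set (cols D))"
    using span_is_monotone[OF li(1)] by (simp add: basis_def)
  then have "q \<in> col_space D" using q by (auto simp: col_space_def)
  then show ?thesis using col_space_eq[OF D] D by auto
qed

section \<open>The noise estimate as a residual norm\<close>

text \<open>
  Write \<open>Q\<close> for the projection onto the complement of \<open>x = X\<^sub>i\<close> and \<open>D\<close> for \<open>X\<close> without column \<open>i\<close>, so
  that \<open>R = D\<^sup>T Q D\<close> and \<open>V = D\<^sup>T Q y\<close>. As \<open>D\<close> has full row rank, \<open>Q y = D c\<close> for some \<open>c\<close>; then
  \<open>V = R c\<close>, and \<open>V \<bullet> R\<^sup>+ V = c \<bullet> R c = |Q y|\<^sup>2\<close>. Thus the noise estimate is, up to the factor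
  \<open>sqrt (n - 1)\<close>, the length of the component of \<open>y\<close> orthogonal to the selected column.
\<close>

lemma residual_norm:
  fixes X :: "real mat"
  assumes X: "X \<in> carrier_mat n p" and i: "i < p" and y: "y \<in> carrier_vec n"
    and unit: "col X i \<bullet> col X i = 1" and rk: "vec_space.rank n (del_col X i) = n"
  shows "l2_norm (psd_sqrt (pinv (residual_gram X i)) *\<^sub>v residual_corr X y i) =
    sqrt (y \<bullet> y - (col X i \<bullet> y)\<^sup>2)"
proof -
  define x where "x = col X i"
  define C where "C = mat_of_cols n [x]"
  define D where "D = del_col X i"
  define Q where "Q = 1\<^sub>m n - C * transpose_mat C"
  define R where "R = transpose_mat D * Q * D"
  define V where "V = residual_corr X y i"
  let ?m = "p - 1"
  have x: "x \<in> carrier_vec n" "x \<bullet> x = 1" using X i unit by (auto simp: x_def)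
  have C: "C \<in> carrier_mat n 1" unfolding C_def using mat_of_cols_carrier(1)[of n "[x]"] by simp
  have D: "D \<in> carrier_mat n ?m" using X by (simp add: D_def del_col_def)
  have Q: "Q \<in> carrier_mat n n" using C by (auto simp: Q_def)
  have R: "R \<in> carrier_mat ?m ?m" using D Q by (simp add: R_def)
  have R_eq: "residual_gram X i = R"
    using X by (simp add: residual_gram_def Let_def R_def Q_def C_def D_def x_def)
  have Q_entry: "Q $$ (r, s) = (if r = s then 1 else 0) - x $ r * x $ s" if "r < n" "s < n" for r s
    using that C by (simp add: Q_def C_def scalar_prod_def mat_of_cols_def)
  have symQ: "transpose_mat Q = Q"
    using Q by (intro eq_matI) (auto simp: Q_entry mult.commute)
  have Q_apply: "Q *\<^sub>v z = z - (x \<bullet> z) \<cdot>\<^sub>v x" if "z \<in> carrier_vec n" for z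
  proof (rule eq_vecI)
    fix r assume "r < dim_vec (z - (x \<bullet> z) \<cdot>\<^sub>v x)"
    then have r: "r < n" using x by simp
    have "(Q *\<^sub>v z) $ r = (\<Sum>s<n. ((if r = s then 1 else 0) - x $ r * x $ s) * z $ s)"
      using r Q that by (simp add: scalar_prod_def Q_entry lessThan_atLeast0)
    also have "\<dots> = (\<Sum>s<n. (if s = r then z $ s else 0) - x $ s * z $ s * x $ r)"
      by (intro sum.cong) (auto simp: algebra_simps)
    also have "\<dots> = z $ r - (x \<bullet> z) * x $ r"
      using r that by (simp add: sum_subtractf sum_distrib_right scalar_prod_def lessThan_atLeast0)
    finally show "(Q *\<^sub>v z) $ r = (z - (x \<bullet> z) \<cdot>\<^sub>v x) $ r"
      using r x that by simp
  qed (use Q x in simp)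
  have x_orth: "x \<bullet> (Q *\<^sub>v z) = 0" if "z \<in> carrier_vec n" for z
    using that x by (simp add: Q_apply scalar_prod_minus_distrib[of _ n])
  have Q_carrier: "Q *\<^sub>v z \<in> carrier_vec n" if "z \<in> carrier_vec n" for z
    using Q that by simp
  have QQ: "Q *\<^sub>v (Q *\<^sub>v z) = Q *\<^sub>v z" if z: "z \<in> carrier_vec n" for z
  proof -
    have "Q *\<^sub>v z - 0 \<cdot>\<^sub>v x = Q *\<^sub>v z"
      using Q x by (intro eq_vecI) auto
    then show ?thesis using Q_apply[OF Q_carrier[OF z]] x_orth[OF z] by simp
  qed
  have Q_form: "z \<bullet> (Q *\<^sub>v z) = (Q *\<^sub>v z) \<bullet> (Q *\<^sub>v z)" if z: "z \<in> carrier_vec n" for z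
    using symmetric_mat_scalar_prod[OF Q symQ Q_carrier[OF z] z] QQ[OF z] by simp
  have R_apply: "R *\<^sub>v c = transpose_mat D *\<^sub>v (Q *\<^sub>v (D *\<^sub>v c))" if "c \<in> carrier_vec ?m" for c
    using that D Q
    by (simp add: R_def assoc_mult_mat_vec[of _ ?m n _ ?m] assoc_mult_mat_vec[of _ ?m n _ n]
        mult_carrier_mat[of _ ?m n _ n] mult_mat_vec_carrier[of _ n ?m])
  have D_adj: "c \<bullet> (transpose_mat D *\<^sub>v z) = (D *\<^sub>v c) \<bullet> z"
    if "c \<in> carrier_vec ?m" "z \<in> carrier_vec n" for c z
  proof -
    have "c \<bullet> (transpose_mat D *\<^sub>v z) = (transpose_mat D *\<^sub>v z) \<bullet> c"
      using that D by (intro comm_scalar_prod[of _ ?m]) auto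
    also have "\<dots> = z \<bullet> (D *\<^sub>v c)" by (rule transpose_vec_mult_scalar[OF D that])
    also have "\<dots> = (D *\<^sub>v c) \<bullet> z" using that D by (intro comm_scalar_prod[of _ n]) auto
    finally show ?thesis .
  qed
  have "psd_mat R"
    unfolding psd_mat_def
  proof (intro conjI ballI)
    show "square_mat R" using R by auto
    have DT: "transpose_mat D \<in> carrier_mat ?m n" using D by simp
    have "transpose_mat R = transpose_mat D * (transpose_mat Q * D)"
      unfolding R_def using D Q by (simp only: transpose_mult[OF mult_carrier_mat[OF DT Q] D] transpose_mult[OF DT Q] transpose_transpose)
    then show "transpose_mat R = R"
      unfolding R_def symQ using assoc_mult_mat[OF DT Q D] by simp
    fix v :: "real vec" assume "v \<in> carrier_vec (dim_col R)"
    then have v: "v \<in> carrier_vec ?m" using R by simp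
    have Dv: "D *\<^sub>v v \<in> carrier_vec n" using D v by simp
    have "v \<bullet> (R *\<^sub>v v) = (Q *\<^sub>v (D *\<^sub>v v)) \<bullet> (Q *\<^sub>v (D *\<^sub>v v))"
      using v D_adj[OF v Q_carrier[OF Dv]] Q_form[OF Dv] by (simp add: R_apply)
    also have "\<dots> \<ge> 0" by (auto simp: scalar_prod_def intro!: sum_nonneg)
    finally show "0 \<le> v \<bullet> (R *\<^sub>v v)" .
  qed
  note psdR = pinv_psd[OF R this]
  define S where "S = psd_sqrt (pinv R)"
  have S: "S \<in> carrier_mat ?m ?m" "transpose_mat S = S" "S * S = pinv R"
    using psd_sqrt[OF psdR(1,2)] by (auto simp: S_def psd_mat_def)
  define q where "q = Q *\<^sub>v y"
  have q: "q \<in> carrier_vec n" using Q_carrier[OF y] by (simp add: q_def)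
  obtain c where c: "c \<in> carrier_vec ?m" "D *\<^sub>v c = q"
    using vec_space_rank_full_surj[OF D rk[folded D_def] q] by blast
  have V_eq: "V = transpose_mat D *\<^sub>v q"
  proof (rule eq_vecI)
    fix k assume "k < dim_vec (transpose_mat D *\<^sub>v q)"
    then have k: "k < ?m" using D by simp
    let ?j = "insert_index i k"
    have j: "?j < p" using k i by (auto simp: insert_index_def)
    have colD: "col D k = col X ?j"
      using X k j by (intro eq_vecI) (auto simp: D_def del_col_def)
    have "(transpose_mat D *\<^sub>v q) $ k = col X ?j \<bullet> (y - (x \<bullet> y) \<cdot>\<^sub>v x)"
      using k D by (simp add: colD q_def Q_apply[OF y])
    also have "\<dots> = col X ?j \<bullet> y - (x \<bullet> y) * (col X ?j \<bullet> x)"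
      using X x y j by (simp add: scalar_prod_minus_distrib[of _ n])
    also have "\<dots> = V $ k"
      using X k j i by (simp add: V_def residual_corr_def Let_def corr_def gram_def x_def)
    finally show "V $ k = (transpose_mat D *\<^sub>v q) $ k" by simp
  qed (use X D in \<open>simp add: V_def residual_corr_def\<close>)
  have V: "V \<in> carrier_vec ?m" using D q by (simp add: V_eq)
  have Rc: "R *\<^sub>v c = V"
    unfolding R_apply[OF c(1)] c(2) V_eq using QQ[OF y] by (simp add: q_def)
  have "(S *\<^sub>v V) \<bullet> (S *\<^sub>v V) = V \<bullet> (S *\<^sub>v (S *\<^sub>v V))"
    using S V by (intro symmetric_mat_scalar_prod[of _ ?m]) auto
  also have "\<dots> = V \<bullet> (pinv R *\<^sub>v V)"
    using S V by (simp add: S(3)[symmetric] assoc_mult_mat_vec[of _ ?m ?m _ ?m])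
  also have "\<dots> = c \<bullet> (R *\<^sub>v (pinv R *\<^sub>v V))"
    unfolding Rc[symmetric] using R psdR(1) c(1) \<open>psd_mat R\<close>
    by (intro symmetric_mat_scalar_prod[of _ ?m]) (auto simp: psd_mat_def)
  also have "R *\<^sub>v (pinv R *\<^sub>v V) = (R * pinv R * R) *\<^sub>v c"
    unfolding Rc[symmetric] using R psdR(1) c(1)
    by (simp add: assoc_mult_mat_vec[of _ ?m ?m _ ?m] mult_carrier_mat[of _ ?m ?m _ ?m]
        mult_mat_vec_carrier[of _ ?m ?m])
  also have "c \<bullet> \<dots> = q \<bullet> q"
    unfolding psdR(3) Rc V_eq D_adj[OF c(1) q] c(2) ..
  also have "q \<bullet> q = y \<bullet> q"
    using Q_form[OF y] by (simp add: q_def)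
  also have "\<dots> = y \<bullet> y - (x \<bullet> y)\<^sup>2"
    using x y comm_scalar_prod[OF y x(1)]
    by (simp add: q_def Q_apply scalar_prod_minus_distrib[of _ n] power2_eq_square)
  finally show ?thesis
    by (simp add: l2_norm_def R_eq S_def V_def x_def)
qed

section \<open>Lebesgue measure on coordinate functions\<close>

abbreviation lebesgue_coords :: "nat \<Rightarrow> (nat \<Rightarrow> real) measure" where
  "lebesgue_coords n \<equiv> Pi\<^sub>M {..<n} (\<lambda>_. lborel)"

definition ip :: "nat \<Rightarrow> (nat \<Rightarrow> real) \<Rightarrow> (nat \<Rightarrow> real) \<Rightarrow> real" where
  "ip n v w = (\<Sum>i<n. v i * w i)"

definition slide :: "nat \<Rightarrow> (nat \<Rightarrow> real) \<Rightarrow> real \<Rightarrow> (nat \<Rightarrow> real) \<Rightarrow> nat \<Rightarrow> real" where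
  "slide n w x z = (\<lambda>i\<in>{..<n}. z i + x * w i)"

definition dilate :: "nat \<Rightarrow> real \<Rightarrow> (nat \<Rightarrow> real) \<Rightarrow> nat \<Rightarrow> real" where
  "dilate n a z = (\<lambda>i\<in>{..<n}. a * z i)"

lemma ip_commute: "ip n v w = ip n w v"
  by (simp add: ip_def mult.commute)

lemma ip_slide: "ip n v (slide n w x z) = ip n v z + x * ip n v w"
  by (simp add: ip_def slide_def sum.distrib sum_distrib_left algebra_simps)

lemma ip_slide_slide:
  "ip n (slide n w x z) (slide n w x z) = ip n z z + 2 * x * ip n w z + x\<^sup>2 * ip n w w"
  by (simp add: ip_def slide_def sum.distrib sum_distrib_left algebra_simps power2_eq_square)

lemma ip_dilate: "ip n v (dilate n a z) = a * ip n v z"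
  by (simp add: ip_def dilate_def sum_distrib_left algebra_simps)

lemma ip_dilate_dilate: "ip n (dilate n a z) (dilate n a z) = a\<^sup>2 * ip n z z"
  by (simp add: ip_def dilate_def sum_distrib_left algebra_simps power2_eq_square)

lemma measurable_ip[measurable]: "ip n v \<in> borel_measurable (lebesgue_coords n)"
  unfolding ip_def[abs_def] by measurable

lemma measurable_ip_self[measurable]: "(\<lambda>z. ip n z z) \<in> borel_measurable (lebesgue_coords n)"
  unfolding ip_def[abs_def] by measurable

lemma measurable_slide_pair[measurable]:
  "(\<lambda>(x, z). slide n w x z) \<in> lborel \<Otimes>\<^sub>M lebesgue_coords n \<rightarrow>\<^sub>M lebesgue_coords n"
  unfolding slide_def[abs_def] split_beta' by measurable

lemma measurable_slide[measurable]:
  "slide n w x \<in> lebesgue_coords n \<rightarrow>\<^sub>M lebesgue_coords n"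
  unfolding slide_def[abs_def] by measurable

lemma measurable_slide_line[measurable]:
  "(\<lambda>x. slide n w x z) \<in> lborel \<rightarrow>\<^sub>M lebesgue_coords n"
  unfolding slide_def[abs_def] by measurable

lemma measurable_dilate[measurable]:
  "dilate n a \<in> lebesgue_coords n \<rightarrow>\<^sub>M lebesgue_coords n"
  unfolding dilate_def[abs_def] by measurable

text \<open>
  Both sides define measures that agree on boxes.
\<close>

lemma nn_integral_lebesgue_coords_affine:
  assumes a: "a \<noteq> 0" and G: "G \<in> borel_measurable (lebesgue_coords n)"
  shows "(\<integral>\<^sup>+z. G z \<partial>lebesgue_coords n) =
    ennreal (\<bar>a\<bar> ^ n) * (\<integral>\<^sup>+z. G (\<lambda>i\<in>{..<n}. c i + a * z i) \<partial>lebesgue_coords n)"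
proof -
  interpret product_sigma_finite "\<lambda>_::nat. lborel :: real measure" by standard
  let ?L = "lebesgue_coords n" and ?T = "\<lambda>z. \<lambda>i\<in>{..<n}. c i + a * z i"
  have T[measurable]: "?T \<in> ?L \<rightarrow>\<^sub>M ?L" by measurable
  have "density (distr ?L ?L ?T) (\<lambda>_. ennreal (\<bar>a\<bar> ^ n)) = ?L"
  proof (rule PiM_eqI)
    fix A :: "nat \<Rightarrow> real set" assume A: "\<And>i. i \<in> {..<n} \<Longrightarrow> A i \<in> sets lborel"
    have box: "Pi\<^sub>E {..<n} A \<in> sets ?L" using A by (intro sets_PiM_I_finite) auto
    have one: "emeasure lborel (A i) = ennreal \<bar>a\<bar> * emeasure lborel ((\<lambda>x. c i + a * x) -` A i)"
      if "i < n" for i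
    proof -
      have [measurable]: "A i \<in> sets borel" using A[of i] that by simp
      show ?thesis
        by (subst lborel_real_affine[OF a, of "c i"])
          (simp add: emeasure_density nn_integral_distr nn_integral_cmult emeasure_distr)
    qed
    have "emeasure (density (distr ?L ?L ?T) (\<lambda>_. ennreal (\<bar>a\<bar> ^ n))) (Pi\<^sub>E {..<n} A) =
        ennreal (\<bar>a\<bar> ^ n) * emeasure (distr ?L ?L ?T) (Pi\<^sub>E {..<n} A)"
      using box by (subst emeasure_density) (auto simp: nn_integral_cmult)
    also have "emeasure (distr ?L ?L ?T) (Pi\<^sub>E {..<n} A) =
        emeasure ?L (?T -` (Pi\<^sub>E {..<n} A) \<inter> space ?L)"
      using box by (simp add: emeasure_distr)
    also have "?T -` (Pi\<^sub>E {..<n} A) \<inter> space ?L =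
        Pi\<^sub>E {..<n} (\<lambda>i. (\<lambda>x. c i + a * x) -` A i)"
      by (auto simp: space_PiM PiE_iff)
    also have "emeasure ?L \<dots> = (\<Prod>i<n. emeasure lborel ((\<lambda>x. c i + a * x) -` A i))"
    proof (rule emeasure_PiM)
      fix i assume "i \<in> {..<n}"
      then have [measurable]: "A i \<in> sets borel" using A by simp
      have "(\<lambda>x. c i + a * x) -` A i \<inter> space borel \<in> sets borel" by measurable
      then show "(\<lambda>x. c i + a * x) -` A i \<in> sets lborel" by simp
    qed simp
    also have "ennreal (\<bar>a\<bar> ^ n) * \<dots> =
        (\<Prod>i<n. ennreal \<bar>a\<bar> * emeasure lborel ((\<lambda>x. c i + a * x) -` A i))"
      by (simp add: prod.distrib ennreal_power)
    also have "\<dots> = (\<Prod>i<n. emeasure lborel (A i))"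
      by (intro prod.cong) (auto simp: one)
    finally show "emeasure (density (distr ?L ?L ?T) (\<lambda>_. ennreal (\<bar>a\<bar> ^ n))) (Pi\<^sub>E {..<n} A) =
        (\<Prod>i<n. emeasure lborel (A i))" .
  qed auto
  then have "(\<integral>\<^sup>+z. G z \<partial>?L) = (\<integral>\<^sup>+z. G z \<partial>density (distr ?L ?L ?T) (\<lambda>_. ennreal (\<bar>a\<bar> ^ n)))"
    by simp
  also have "\<dots> = ennreal (\<bar>a\<bar> ^ n) * (\<integral>\<^sup>+z. G (?T z) \<partial>?L)"
    using G by (subst nn_integral_density) (auto simp: nn_integral_cmult nn_integral_distr)
  finally show ?thesis .
qed

lemma nn_integral_slide:
  assumes "G \<in> borel_measurable (lebesgue_coords n)"
  shows "(\<integral>\<^sup>+z. G (slide n w x z) \<partial>lebesgue_coords n) = (\<integral>\<^sup>+z. G z \<partial>lebesgue_coords n)"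
  using nn_integral_lebesgue_coords_affine[of 1 G n "\<lambda>i. x * w i"] assms
  by (simp add: slide_def add.commute cong: restrict_cong)

lemma nn_integral_dilate:
  assumes "a > 0" "G \<in> borel_measurable (lebesgue_coords n)"
  shows "(\<integral>\<^sup>+z. G z \<partial>lebesgue_coords n) =
    ennreal (a ^ n) * (\<integral>\<^sup>+z. G (dilate n a z) \<partial>lebesgue_coords n)"
  using nn_integral_lebesgue_coords_affine[of a G n "\<lambda>i. 0"] assms
  by (simp add: dilate_def)

lemma pair_sigma_finite_lebesgue_coords: "pair_sigma_finite (lborel :: real measure) (lebesgue_coords n)"
proof -
  interpret product_sigma_finite "\<lambda>_::nat. lborel :: real measure" by standard
  have "sigma_finite_measure (lebesgue_coords n)" by (rule sigma_finite) simp
  then show ?thesis by (intro pair_sigma_finite.intro) (auto simp: lborel.sigma_finite_measure_axioms)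
qed

lemma nn_integral_lborel_reflect:
  fixes \<psi> :: "real \<Rightarrow> ennreal"
  assumes "\<psi> \<in> borel_measurable borel"
  shows "(\<integral>\<^sup>+x. \<psi> (t - x) \<partial>lborel) = (\<integral>\<^sup>+x. \<psi> x \<partial>lborel)"
  using nn_integral_real_affine[of \<psi> "-1" t] assms by simp

lemma nn_integral_lborel_translate:
  fixes \<psi> :: "real \<Rightarrow> ennreal"
  assumes "\<psi> \<in> borel_measurable borel"
  shows "(\<integral>\<^sup>+x. \<psi> (t + x) \<partial>lborel) = (\<integral>\<^sup>+x. \<psi> x \<partial>lborel)"
  using nn_integral_real_affine[of \<psi> 1 t] assms by simp

text \<open>
  Lebesgue measure disintegrates along the lines in a unit direction \<open>w\<close>: average over the
  translates \<open>z + x w\<close> with the weight \<open>\<psi> (w \<bullet> z)\<close>. Exchanging the integrals and translating back moves the weight to \<open>\<psi> (w \<bullet> z - x)\<close>, which integrates to 1 over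
  \<open>x\<close>. The profile \<open>\<psi>\<close> plays the part of a thickened transversal hyperplane.
\<close>

lemma nn_integral_along_lines:
  fixes \<psi> :: "real \<Rightarrow> ennreal"
  assumes w: "ip n w w = 1" and [measurable]: "\<psi> \<in> borel_measurable borel"
    and \<psi>: "(\<integral>\<^sup>+x. \<psi> x \<partial>lborel) = 1"
    and [measurable]: "G \<in> borel_measurable (lebesgue_coords n)"
  shows "(\<integral>\<^sup>+z. G z \<partial>lebesgue_coords n) =
    (\<integral>\<^sup>+z. \<psi> (ip n w z) * (\<integral>\<^sup>+x. G (slide n w x z) \<partial>lborel) \<partial>lebesgue_coords n)"
proof -
  let ?L = "lebesgue_coords n"
  interpret pair_sigma_finite "lborel :: real measure" ?L by (rule pair_sigma_finite_lebesgue_coords)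
  have [measurable]: "(\<lambda>(x, z). G (slide n w x z)) \<in> borel_measurable (lborel \<Otimes>\<^sub>M ?L)"
    using measurable_compose[OF measurable_slide_pair[of n w], of G borel] by (simp add: split_beta')
  have "(\<integral>\<^sup>+z. \<psi> (ip n w z) * (\<integral>\<^sup>+x. G (slide n w x z) \<partial>lborel) \<partial>?L)
      = (\<integral>\<^sup>+z. (\<integral>\<^sup>+x. \<psi> (ip n w z) * G (slide n w x z) \<partial>lborel) \<partial>?L)"
    by (simp add: nn_integral_cmult)
  also have "\<dots> = (\<integral>\<^sup>+x. (\<integral>\<^sup>+z. \<psi> (ip n w z) * G (slide n w x z) \<partial>?L) \<partial>lborel)"
    by (rule Fubini') measurable
  also have "\<dots> = (\<integral>\<^sup>+x. (\<integral>\<^sup>+z. \<psi> (ip n w z - x) * G z \<partial>?L) \<partial>lborel)"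
  proof (rule nn_integral_cong)
    fix x
    have "(\<integral>\<^sup>+z. \<psi> (ip n w z) * G (slide n w x z) \<partial>?L)
       = (\<integral>\<^sup>+z. (\<lambda>z. \<psi> (ip n w z - x) * G z) (slide n w x z) \<partial>?L)"
      by (simp add: ip_slide w)
    also have "\<dots> = (\<integral>\<^sup>+z. \<psi> (ip n w z - x) * G z \<partial>?L)"
      by (rule nn_integral_slide) measurable
    finally show "(\<integral>\<^sup>+z. \<psi> (ip n w z) * G (slide n w x z) \<partial>?L) =
       (\<integral>\<^sup>+z. \<psi> (ip n w z - x) * G z \<partial>?L)" .
  qed
  also have "\<dots> = (\<integral>\<^sup>+z. (\<integral>\<^sup>+x. \<psi> (ip n w z - x) * G z \<partial>lborel) \<partial>?L)"
    by (rule Fubini'[symmetric]) measurable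
  also have "\<dots> = (\<integral>\<^sup>+z. G z \<partial>?L)"
    by (intro nn_integral_cong) (simp add: nn_integral_multc nn_integral_lborel_reflect \<psi>)
  finally show ?thesis ..
qed

text \<open>
  For integrands that are constant along the lines, the choice of the transversal is immaterial.
\<close>

lemma nn_integral_profile_independent:
  fixes \<psi> \<psi>' :: "real \<Rightarrow> ennreal"
  assumes w: "ip n w w = 1" and [measurable]: "\<psi> \<in> borel_measurable borel" "\<psi>' \<in> borel_measurable borel"
    and \<psi>: "(\<integral>\<^sup>+x. \<psi> x \<partial>lborel) = 1" "(\<integral>\<^sup>+x. \<psi>' x \<partial>lborel) = 1"
    and [measurable]: "F \<in> borel_measurable (lebesgue_coords n)"
    and F: "\<And>x z. F (slide n w x z) = F z"
  shows "(\<integral>\<^sup>+z. \<psi> (ip n w z) * F z \<partial>lebesgue_coords n) = (\<integral>\<^sup>+z. \<psi>' (ip n w z) * F z \<partial>lebesgue_coords n)"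
proof -
  have "(\<integral>\<^sup>+z. \<psi> (ip n w z) * F z \<partial>lebesgue_coords n) =
    (\<integral>\<^sup>+z. \<psi>' (ip n w z) * (\<integral>\<^sup>+x. \<psi> (ip n w (slide n w x z)) * F (slide n w x z) \<partial>lborel) \<partial>lebesgue_coords n)"
    by (rule nn_integral_along_lines[OF w _ \<psi>(2)]) measurable
  also have "\<dots> = (\<integral>\<^sup>+z. \<psi>' (ip n w z) * F z \<partial>lebesgue_coords n)"
    by (intro nn_integral_cong)
      (simp add: F ip_slide w nn_integral_multc nn_integral_lborel_translate \<psi>)
  finally show ?thesis .
qed

section \<open>The Gaussian measure and the t-ratio\<close>

text \<open>
  The length of the component of \<open>z\<close> orthogonal to the unit vector \<open>w\<close>.
\<close>

definition perp :: "nat \<Rightarrow> (nat \<Rightarrow> real) \<Rightarrow> (nat \<Rightarrow> real) \<Rightarrow> real" where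
  "perp n w z = sqrt (ip n z z - (ip n w z)\<^sup>2)"

lemma ip_self_nonneg: "0 \<le> ip n z z"
  by (auto simp: ip_def intro!: sum_nonneg)

lemma ip_square_le: 
  assumes "ip n w w = 1" shows "(ip n w z)\<^sup>2 \<le> ip n z z"
proof -
  have "0 \<le> ip n (slide n w (- ip n w z) z) (slide n w (- ip n w z) z)" by (rule ip_self_nonneg)
  also have "\<dots> = ip n z z - (ip n w z)\<^sup>2"
    unfolding ip_slide_slide assms by (simp add: power2_eq_square)
  finally show ?thesis by simp
qed

lemma perp_nonneg: "ip n w w = 1 \<Longrightarrow> 0 \<le> perp n w z"
  using ip_square_le[of n w z] by (simp add: perp_def)

lemma perp_square: "ip n w w = 1 \<Longrightarrow> (perp n w z)\<^sup>2 = ip n z z - (ip n w z)\<^sup>2"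
  using ip_square_le[of n w z] by (simp add: perp_def)

lemma perp_slide: "ip n w w = 1 \<Longrightarrow> perp n w (slide n w x z) = perp n w z"
  unfolding perp_def unfolding ip_slide_slide unfolding ip_slide by (simp add: power2_eq_square algebra_simps)

lemma perp_dilate: "0 \<le> a \<Longrightarrow> perp n w (dilate n a z) = a * perp n w z"
proof -
  assume a: "0 \<le> a"
  have "perp n w (dilate n a z) = sqrt (a\<^sup>2 * (ip n z z - (ip n w z)\<^sup>2))"
    unfolding perp_def unfolding ip_dilate_dilate unfolding ip_dilate by (simp add: power2_eq_square algebra_simps)
  then show ?thesis using a by (simp add: perp_def real_sqrt_mult)
qed

lemma measurable_perp[measurable]: "perp n w \<in> borel_measurable (lebesgue_coords n)"
  unfolding perp_def[abs_def] by measurable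

definition gauss :: "nat \<Rightarrow> (nat \<Rightarrow> real) \<Rightarrow> real" where
  "gauss n z = (1 / sqrt (2 * pi)) ^ n * exp (- ip n z z / 2)"

lemma measurable_gauss[measurable]: "gauss n \<in> borel_measurable (lebesgue_coords n)"
  unfolding gauss_def[abs_def] by measurable

lemma gauss_eq_prod: "gauss n z = (\<Prod>i<n. std_normal_density (z i))"
proof -
  have "- ip n z z / 2 = (\<Sum>i<n. - (z i)\<^sup>2 / 2)"
    by (simp add: ip_def sum_negf sum_divide_distrib power2_eq_square)
  then show ?thesis
    by (simp add: gauss_def std_normal_density_def prod_dividef exp_sum power_divide)
qed

lemma PiM_std_normal_eq_density:
  "Pi\<^sub>M {..<n} (\<lambda>_. std_normal_distribution) = density (lebesgue_coords n) (\<lambda>z. ennreal (gauss n z))"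
proof -
  interpret L: product_sigma_finite "\<lambda>_::nat. lborel :: real measure" by standard
  interpret N: product_prob_space "\<lambda>_::nat. std_normal_distribution"
    by (intro product_prob_spaceI prob_space_normal_density) simp
  have "density (lebesgue_coords n) (\<lambda>z. ennreal (gauss n z)) = Pi\<^sub>M {..<n} (\<lambda>_. std_normal_distribution)"
  proof (rule N.PiM_eqI)
    show "sets (density (lebesgue_coords n) (\<lambda>z. ennreal (gauss n z))) =
        sets (Pi\<^sub>M {..<n} (\<lambda>_. std_normal_distribution))"
      by (simp add: sets_PiM_cong[of "{..<n}" _ "\<lambda>_. lborel" "\<lambda>_. std_normal_distribution"])
    fix A :: "nat \<Rightarrow> real set" assume "\<And>i. i \<in> {..<n} \<Longrightarrow> A i \<in> sets std_normal_distribution"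
    then have A: "A i \<in> sets borel" if "i < n" for i using that by simp
    have box: "Pi\<^sub>E {..<n} A \<in> sets (lebesgue_coords n)" using A by (intro sets_PiM_I_finite) auto
    have "emeasure (density (lebesgue_coords n) (\<lambda>z. ennreal (gauss n z))) (Pi\<^sub>E {..<n} A) =
        (\<integral>\<^sup>+z. ennreal (gauss n z) * indicator (Pi\<^sub>E {..<n} A) z \<partial>lebesgue_coords n)"
      using box by (intro emeasure_density) auto
    also have "\<dots> = (\<integral>\<^sup>+z. (\<Prod>i<n. ennreal (std_normal_density (z i)) * indicator (A i) (z i)) \<partial>lebesgue_coords n)"
    proof (rule nn_integral_cong)
      fix z assume z: "z \<in> space (lebesgue_coords n)"
      have "indicator (Pi\<^sub>E {..<n} A) z = (\<Prod>i<n. indicator (A i) (z i) :: ennreal)"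
      proof (cases "z \<in> Pi\<^sub>E {..<n} A")
        case True then show ?thesis by (auto simp: PiE_iff intro!: prod.neutral[symmetric])
      next
        case False
        then obtain i where "i < n" "z i \<notin> A i" using z by (auto simp: PiE_iff space_PiM)
        then show ?thesis using False by (auto intro!: prod_zero[symmetric] bexI[of _ i])
      qed
      then show "ennreal (gauss n z) * indicator (Pi\<^sub>E {..<n} A) z =
          (\<Prod>i<n. ennreal (std_normal_density (z i)) * indicator (A i) (z i))"
        by (simp add: gauss_eq_prod prod.distrib prod_ennreal)
    qed
    also have "\<dots> = (\<Prod>i<n. \<integral>\<^sup>+x. ennreal (std_normal_density x) * indicator (A i) x \<partial>lborel)"
      using A by (intro L.product_nn_integral_prod) auto
    also have "\<dots> = (\<Prod>i<n. emeasure std_normal_distribution (A i))"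
      using A by (intro prod.cong) (auto simp: emeasure_density)
    finally show "emeasure (density (lebesgue_coords n) (\<lambda>z. ennreal (gauss n z))) (Pi\<^sub>E {..<n} A) =
        (\<Prod>i<n. emeasure std_normal_distribution (A i))" .
  qed simp
  then show ?thesis ..
qed

lemma nn_integral_std_normal_density: "(\<integral>\<^sup>+x. ennreal (std_normal_density x) \<partial>lborel) = 1"
proof -
  interpret prob_space std_normal_distribution by (rule prob_space_normal_density) simp
  show ?thesis using emeasure_space_1 by (simp add: emeasure_density)
qed

text \<open>
  This is the independence of the \<open>t\<close>-ratio from the direction of the orthogonal component, in the
  form of an integral formula. On a line in direction \<open>w\<close>, substitute \<open>x = t |q| / sqrt \<nu>\<close>, where \<open>q\<close>
  is the orthogonal component: the Gaussian density becomes a function of \<open>|q|\<^sup>2 (1 + t\<^sup>2 / \<nu>)\<close>. As \<open>H t\<close> is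
  homogeneous of degree 0, dilating the space by \<open>(1 + t\<^sup>2 / \<nu>)\<^bsup>-1/2\<^esup>\<close> then splits off the Student
  kernel, and what remains is a fixed measure in \<open>z\<close>.
\<close>

lemma gauss_polar:
  fixes H :: "real \<Rightarrow> (nat \<Rightarrow> real) \<Rightarrow> ennreal"
  assumes n: "n \<ge> 2" and w: "ip n w w = 1"
    and H[measurable]: "(\<lambda>(t, z). H t z) \<in> borel_measurable (lborel \<Otimes>\<^sub>M lebesgue_coords n)"
    and H_slide: "\<And>t x z. H t (slide n w x z) = H t z"
    and H_dilate: "\<And>t a z. 0 < a \<Longrightarrow> H t (dilate n a z) = H t z"
  defines "\<nu> \<equiv> real n - 1"
  shows "(\<integral>\<^sup>+z. (if perp n w z > 0
               then ennreal (gauss n z) * H (sqrt \<nu> * ip n w z / perp n w z) z else 0)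
             \<partial>lebesgue_coords n) =
    (\<integral>\<^sup>+z. ennreal (std_normal_density (ip n w z)) *
            (ennreal ((1 / sqrt (2 * pi)) ^ n * (perp n w z / sqrt \<nu>) * exp (- (perp n w z)\<^sup>2 / 2)) *
             (\<integral>\<^sup>+t. ennreal ((1 + t\<^sup>2 / \<nu>) powr (- (\<nu> + 1) / 2)) * H t z \<partial>lborel))
       \<partial>lebesgue_coords n)"
proof -
  let ?L = "lebesgue_coords n" and ?R = "perp n w" and ?\<phi> = "\<lambda>u. ennreal (std_normal_density u)"
  let ?K = "(1 / sqrt (2 * pi)) ^ n :: real"
  define F where "F z = (if ?R z > 0 then ennreal (gauss n z) * H (sqrt \<nu> * ip n w z / ?R z) z else 0)" for z
  define c where "c z = ?K * (?R z / sqrt \<nu>) * exp (- (?R z)\<^sup>2 / 2)" for z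
  define E where "E t z = ennreal (?K * (?R z / sqrt \<nu>) * exp (- (?R z)\<^sup>2 * (1 + t\<^sup>2 / \<nu>) / 2)) * H t z" for t z
  define b where "b t = sqrt (1 + t\<^sup>2 / \<nu>)" for t
  have \<nu>: "\<nu> > 0" "real n = \<nu> + 1" using n by (auto simp: \<nu>_def)
  have b: "b t > 0" "(b t)\<^sup>2 = 1 + t\<^sup>2 / \<nu>" for t
    using \<nu> by (auto simp: b_def add_pos_nonneg)
  interpret pair_sigma_finite "lborel :: real measure" ?L by (rule pair_sigma_finite_lebesgue_coords)
  have R0: "0 \<le> ?R z" for z by (rule perp_nonneg[OF w])
  have Ht[measurable]: "H t \<in> borel_measurable ?L" for t
    using measurable_compose[OF measurable_Pair1' H, of t] by simp
  have Hz[measurable]: "(\<lambda>t. H t z) \<in> borel_measurable lborel" if "z \<in> space ?L" for z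
    using measurable_compose[OF measurable_Pair2'[OF that] H] by simp
  have [measurable]: "(\<lambda>(t, z). E t z) \<in> borel_measurable (lborel \<Otimes>\<^sub>M ?L)"
    unfolding E_def by measurable
  have [measurable]: "E t \<in> borel_measurable ?L" for t
    unfolding E_def[abs_def] by measurable
  have "(\<lambda>z. H (sqrt \<nu> * ip n w z / ?R z) z) \<in> borel_measurable ?L"
    using measurable_compose[OF _ H, of "\<lambda>z. (sqrt \<nu> * ip n w z / ?R z, z)" ?L] by simp
  then have F[measurable]: "F \<in> borel_measurable ?L"
    unfolding F_def[abs_def] by measurable
  \<comment> \<open>On the line through \<open>z\<close>, substitute \<open>x = - (w \<bullet> z) + t |q| / sqrt \<nu>\<close> with \<open>|q| = perp n w z\<close>.\<close>
  have line: "(\<integral>\<^sup>+x. F (slide n w x z) \<partial>lborel) = (\<integral>\<^sup>+t. E t z \<partial>lborel)" if z: "z \<in> space ?L" for z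
  proof (cases "?R z > 0")
    case False
    then have "?R z = 0" using R0[of z] by simp
    then show ?thesis by (simp add: F_def E_def perp_slide[OF w])
  next
    case R: True
    let ?s = "?R z / sqrt \<nu>"
    have s: "?s > 0" using R \<nu> by simp
    have Fx: "F (slide n w x z) = ennreal (?K * exp (- ((?R z)\<^sup>2 + (ip n w z + x)\<^sup>2) / 2)) *
        H (sqrt \<nu> * (ip n w z + x) / ?R z) z" for x
    proof -
      have "ip n (slide n w x z) (slide n w x z) = (?R z)\<^sup>2 + (ip n w z + x)\<^sup>2"
        unfolding ip_slide_slide w perp_square[OF w] by (simp add: power2_eq_square algebra_simps)
      then show ?thesis
        using R by (simp add: F_def gauss_def perp_slide[OF w] ip_slide w H_slide)
    qed
    have [measurable]: "(\<lambda>x. F (slide n w x z)) \<in> borel_measurable borel"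
      using measurable_compose[OF measurable_slide_line F] by simp
    have "(\<integral>\<^sup>+x. F (slide n w x z) \<partial>lborel) = ennreal ?s * (\<integral>\<^sup>+t. F (slide n w (- ip n w z + ?s * t) z) \<partial>lborel)"
      using nn_integral_real_affine[of "\<lambda>x. F (slide n w x z)" ?s "- ip n w z"] less_imp_neq[OF s, symmetric]
      unfolding abs_of_pos[OF s] by (simp only: \<open>(\<lambda>x. F (slide n w x z)) \<in> borel_measurable borel\<close> simp_thms)
    also have "\<dots> = (\<integral>\<^sup>+t. ennreal ?s * F (slide n w (- ip n w z + ?s * t) z) \<partial>lborel)"
      by (rule nn_integral_cmult[symmetric]) measurable
    also have "\<dots> = (\<integral>\<^sup>+t. E t z \<partial>lborel)"
    proof (rule nn_integral_cong)
      fix t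
      have 1: "sqrt \<nu> * (?s * t) / ?R z = t" using R \<nu> by simp
      have 2: "(?R z)\<^sup>2 + (?s * t)\<^sup>2 = (?R z)\<^sup>2 * (1 + t\<^sup>2 / \<nu>)"
        using \<nu> by (simp add: power_divide power_mult_distrib algebra_simps)
      have "ennreal ?s * F (slide n w (- ip n w z + ?s * t) z) =
          ennreal ?s * ennreal (?K * exp (- ((?R z)\<^sup>2 * (1 + t\<^sup>2 / \<nu>)) / 2)) * H t z"
        unfolding Fx using 1 2 by (simp add: mult.assoc)
      also have "\<dots> = E t z"
        using s by (simp add: E_def ennreal_mult[symmetric] mult_ac)
      finally show "ennreal ?s * F (slide n w (- ip n w z + ?s * t) z) = E t z" .
    qed
    finally show ?thesis .
  qed
  \<comment> \<open>The dilation by \<open>1 / b t\<close> also stretches the profile \<open>\<phi>\<close>; profile independence restores it.\<close>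
  have scale: "(\<integral>\<^sup>+z. ?\<phi> (ip n w z) * E t z \<partial>?L) =
      (\<integral>\<^sup>+z. ?\<phi> (ip n w z) * (ennreal (c z) * (ennreal ((1 + t\<^sup>2 / \<nu>) powr (- (\<nu> + 1) / 2)) * H t z)) \<partial>?L)"
    for t
  proof -
    let ?a = "1 / b t" and ?\<phi>' = "\<lambda>u. ennreal (std_normal_density (u / b t) / b t)"
    have a: "?a > 0" using b by simp
    have \<phi>': "(\<integral>\<^sup>+u. ?\<phi>' u \<partial>lborel) = 1"
    proof -
      have "1 = ennreal \<bar>?a\<bar> * (\<integral>\<^sup>+u. ?\<phi> (0 + ?a * u) \<partial>lborel)"
        unfolding nn_integral_std_normal_density[symmetric]
        using a by (intro nn_integral_real_affine) auto
      also have "\<dots> = (\<integral>\<^sup>+u. ennreal \<bar>?a\<bar> * ?\<phi> (0 + ?a * u) \<partial>lborel)"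
        by (rule nn_integral_cmult[symmetric]) measurable
      also have "\<dots> = (\<integral>\<^sup>+u. ?\<phi>' u \<partial>lborel)"
        using a by (intro nn_integral_cong) (simp add: ennreal_mult[symmetric])
      finally show ?thesis ..
    qed
    have E_dil: "E t (dilate n ?a z) = ennreal (?a * c z) * H t z" for z
    proof -
      have "- (?R (dilate n ?a z))\<^sup>2 * (1 + t\<^sup>2 / \<nu>) = - (?R z)\<^sup>2"
        using a b(1)[of t] unfolding b(2)[symmetric]
        by (simp add: perp_dilate power_mult_distrib power_divide)
      then show ?thesis
        using a by (simp add: E_def c_def H_dilate perp_dilate mult_ac)
    qed
    have "(\<integral>\<^sup>+z. ?\<phi> (ip n w z) * E t z \<partial>?L) =
        ennreal (?a ^ n) * (\<integral>\<^sup>+z. ?\<phi> (ip n w (dilate n ?a z)) * E t (dilate n ?a z) \<partial>?L)"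
      by (rule nn_integral_dilate[OF a]) measurable
    also have "(\<integral>\<^sup>+z. ?\<phi> (ip n w (dilate n ?a z)) * E t (dilate n ?a z) \<partial>?L) =
        (\<integral>\<^sup>+z. ?\<phi>' (ip n w z) * (ennreal (c z) * H t z) \<partial>?L)"
    proof (rule nn_integral_cong)
      fix z
      have c0: "0 \<le> c z" using R0[of z] \<nu> by (simp add: c_def)
      have "?\<phi> (ip n w (dilate n ?a z)) * E t (dilate n ?a z) =
          ?\<phi> (ip n w z / b t) * (ennreal ?a * ennreal (c z)) * H t z"
      proof -
        have "ip n w (dilate n ?a z) = ip n w z / b t" by (simp add: ip_dilate)
        moreover have "ennreal (?a * c z) = ennreal ?a * ennreal (c z)"
          using a c0 by (intro ennreal_mult) auto
        ultimately show ?thesis by (simp only: E_dil mult.assoc)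
      qed
      also have "\<dots> = (?\<phi> (ip n w z / b t) * ennreal ?a) * (ennreal (c z) * H t z)"
        by (simp add: mult_ac)
      also have "?\<phi> (ip n w z / b t) * ennreal ?a = ?\<phi>' (ip n w z)"
        using a by (simp add: ennreal_mult[symmetric])
      finally show "?\<phi> (ip n w (dilate n ?a z)) * E t (dilate n ?a z) =
          ?\<phi>' (ip n w z) * (ennreal (c z) * H t z)" .
    qed
    also have "\<dots> = (\<integral>\<^sup>+z. ?\<phi> (ip n w z) * (ennreal (c z) * H t z) \<partial>?L)"
      by (rule nn_integral_profile_independent[OF w _ _ \<phi>' nn_integral_std_normal_density])
        (simp_all add: c_def perp_slide[OF w] H_slide)
    also have "ennreal (?a ^ n) * \<dots> =
        (\<integral>\<^sup>+z. ennreal (?a ^ n) * (?\<phi> (ip n w z) * (ennreal (c z) * H t z)) \<partial>?L)"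
      unfolding c_def by (rule nn_integral_cmult[symmetric]) measurable
    also have "?a ^ n = (1 + t\<^sup>2 / \<nu>) powr (- (\<nu> + 1) / 2)"
    proof -
      have bt: "b t = (1 + t\<^sup>2 / \<nu>) powr (1 / 2)"
        unfolding b_def using \<nu> by (intro powr_half_sqrt[symmetric]) simp
      have "?a ^ n = b t powr (- real n)"
        using b(1)[of t] by (simp add: powr_minus powr_realpow power_divide field_simps)
      also have "\<dots> = (1 + t\<^sup>2 / \<nu>) powr (- (\<nu> + 1) / 2)"
        unfolding bt powr_powr \<nu>(2) by simp
      finally show ?thesis .
    qed
    finally show ?thesis by (simp add: mult_ac)
  qed
  have "(\<integral>\<^sup>+z. F z \<partial>?L) = (\<integral>\<^sup>+z. ?\<phi> (ip n w z) * (\<integral>\<^sup>+x. F (slide n w x z) \<partial>lborel) \<partial>?L)"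
    by (rule nn_integral_along_lines[OF w _ nn_integral_std_normal_density F]) measurable
  also have "\<dots> = (\<integral>\<^sup>+z. (\<integral>\<^sup>+t. ?\<phi> (ip n w z) * E t z \<partial>lborel) \<partial>?L)"
    by (intro nn_integral_cong) (simp add: line nn_integral_cmult E_def)
  also have "\<dots> = (\<integral>\<^sup>+t. (\<integral>\<^sup>+z. ?\<phi> (ip n w z) * E t z \<partial>?L) \<partial>lborel)"
    by (rule Fubini') measurable
  also have "\<dots> = (\<integral>\<^sup>+t. (\<integral>\<^sup>+z. ?\<phi> (ip n w z) *
      (ennreal (c z) * (ennreal ((1 + t\<^sup>2 / \<nu>) powr (- (\<nu> + 1) / 2)) * H t z)) \<partial>?L) \<partial>lborel)"
    by (simp only: scale)
  also have "\<dots> = (\<integral>\<^sup>+z. (\<integral>\<^sup>+t. ?\<phi> (ip n w z) *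
      (ennreal (c z) * (ennreal ((1 + t\<^sup>2 / \<nu>) powr (- (\<nu> + 1) / 2)) * H t z)) \<partial>lborel) \<partial>?L)"
    unfolding c_def by (rule Fubini'[symmetric]) measurable
  also have "\<dots> = (\<integral>\<^sup>+z. ?\<phi> (ip n w z) *
      (ennreal (c z) * (\<integral>\<^sup>+t. ennreal ((1 + t\<^sup>2 / \<nu>) powr (- (\<nu> + 1) / 2)) * H t z \<partial>lborel)) \<partial>?L)"
    by (intro nn_integral_cong) (simp add: nn_integral_cmult)
  finally show ?thesis by (simp add: F_def c_def)
qed

section \<open>Student's distribution\<close>

text \<open>
  Insert \<open>\<Gamma>(s) b\<^bsup>-s\<^esup> = \<integral> u\<^bsup>s-1\<^esup> e\<^bsup>-ub\<^esup> du\<close> with \<open>b = 1 + t\<^sup>2 / \<nu>\<close> and \<open>s = (\<nu> + 1) / 2\<close>; exchanging the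
  integrals leaves a Gaussian integral in \<open>t\<close>.
\<close>

lemma nn_integral_student_kernel:
  assumes \<nu>: "\<nu> > 0"
  shows "(\<integral>\<^sup>+t. ennreal ((1 + t\<^sup>2 / \<nu>) powr (- (\<nu> + 1) / 2)) \<partial>lborel) =
    ennreal (sqrt (\<nu> * pi) * Gamma (\<nu> / 2) / Gamma ((\<nu> + 1) / 2))"
proof -
  define s where "s = (\<nu> + 1) / 2"
  have s: "s > 1 / 2" using \<nu> by (simp add: s_def)
  define g where "g u t = ennreal (indicator {0<..} u * u powr (s - 1) * exp (- u * (1 + t\<^sup>2 / \<nu>)))" for u t :: real
  have Gamma_pos: "Gamma s > 0" using s by (intro Gamma_real_pos) simp
  \<comment> \<open>Both iterated integrals of \<open>g\<close> are explicit: Gamma type in \<open>u\<close>, Gaussian in \<open>t\<close>.\<close>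
  have B: "1 + t\<^sup>2 / \<nu> > 0" for t using \<nu> by (simp add: add_pos_nonneg)
  have Gamma_int: "(\<integral>\<^sup>+u. ennreal (indicator {0<..} u * u powr (r - 1) * exp (- u)) \<partial>lborel) = ennreal (Gamma r)"
    if "r > 0" for r :: real
  proof -
    have "(\<integral>\<^sup>+u. ennreal (indicator {0<..} u * u powr (r - 1) * exp (- u)) \<partial>lborel) =
      (\<integral>\<^sup>+u. ennreal (indicator {0..} u * u powr (r - 1) / exp u) \<partial>lborel)"
      by (intro nn_integral_cong_AE AE_I[of _ _ "{0}"]) (auto simp: exp_minus field_simps split: split_indicator)
    then show ?thesis using Gamma_conv_nn_integral_real[OF that] by simp
  qed
  have u_int: "(\<integral>\<^sup>+u. g u t \<partial>lborel) = ennreal (Gamma s * (1 + t\<^sup>2 / \<nu>) powr (- s))" for t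
  proof -
    define b where "b = 1 + t\<^sup>2 / \<nu>"
    have b: "b > 0" using B[of t] by (simp add: b_def)
    have g: "g u t = ennreal (indicator {0<..} u * u powr (s - 1) * exp (- u * b))" for u
      by (simp add: g_def b_def)
    have "ennreal (Gamma s) = ennreal \<bar>b\<bar> *
        (\<integral>\<^sup>+u. ennreal (indicator {0<..} (0 + b * u) * (0 + b * u) powr (s - 1) * exp (- (0 + b * u))) \<partial>lborel)"
      using s b by (subst Gamma_int[symmetric], simp, intro nn_integral_real_affine) auto
    also have "\<dots> = ennreal \<bar>b\<bar> * (\<integral>\<^sup>+u. ennreal (b powr (s - 1)) * g u t \<partial>lborel)"
      using b
      by (intro arg_cong2[of _ _ _ _ "(*)"] nn_integral_cong refl)
        (auto simp: g powr_mult zero_less_mult_iff ennreal_mult[symmetric] algebra_simps split: split_indicator)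
    also have "\<dots> = ennreal \<bar>b\<bar> * (ennreal (b powr (s - 1)) * (\<integral>\<^sup>+u. g u t \<partial>lborel))"
      by (subst nn_integral_cmult) (auto simp: g)
    also have "\<dots> = ennreal (b powr s) * (\<integral>\<^sup>+u. g u t \<partial>lborel)"
    proof -
      have "\<bar>b\<bar> * b powr (s - 1) = b powr s"
        using b powr_add[of b 1 "s - 1"] by simp
      then show ?thesis
        by (simp add: mult.assoc[symmetric] ennreal_mult[symmetric] del: powr_mult_base)
    qed
    finally have e: "ennreal (Gamma s) = ennreal (b powr s) * (\<integral>\<^sup>+u. g u t \<partial>lborel)" .
    have "ennreal (b powr (- s)) * ennreal (Gamma s) =
        ennreal (b powr (- s) * b powr s) * (\<integral>\<^sup>+u. g u t \<partial>lborel)"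
      unfolding e by (simp add: ennreal_mult mult.assoc)
    also have "b powr (- s) * b powr s = 1"
      using b by (simp add: powr_add[symmetric])
    finally show ?thesis using Gamma_pos by (simp add: ennreal_mult[symmetric] mult.commute b_def)
  qed
  have t_int: "(\<integral>\<^sup>+t. g u t \<partial>lborel) =
      ennreal (sqrt (\<nu> * pi)) * ennreal (indicator {0<..} u * u powr (\<nu> / 2 - 1) * exp (- u))" for u
  proof (cases "u > 0")
    case False then show ?thesis by (simp add: g_def)
  next
    case True
    define \<tau> where "\<tau> = sqrt (\<nu> / (2 * u))"
    have \<tau>: "\<tau> > 0" "\<tau>\<^sup>2 = \<nu> / (2 * u)" using \<nu> True by (auto simp: \<tau>_def)
    interpret prob_space "density lborel (normal_density 0 \<tau>)"
      by (rule prob_space_normal_density[OF \<tau>(1)])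
    have one: "(\<integral>\<^sup>+t. ennreal (normal_density 0 \<tau> t) \<partial>lborel) = 1"
      using emeasure_space_1 by (simp add: emeasure_density)
    have dens: "exp (- u * t\<^sup>2 / \<nu>) = sqrt (\<nu> * pi / u) * normal_density 0 \<tau> t" for t
      using \<nu> True by (simp add: normal_density_def \<tau>(2) real_sqrt_divide real_sqrt_mult field_simps)
    have "g u t = ennreal (u powr (s - 1) * exp (- u) * sqrt (\<nu> * pi / u)) * ennreal (normal_density 0 \<tau> t)" for t
    proof -
      have "exp (- u * (1 + t\<^sup>2 / \<nu>)) = exp (- u) * exp (- u * t\<^sup>2 / \<nu>)"
        by (simp add: exp_add[symmetric] algebra_simps)
      then show ?thesis
        using True \<nu> unfolding g_def dens by (simp add: ennreal_mult[symmetric] mult_ac)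
    qed
    then have "(\<integral>\<^sup>+t. g u t \<partial>lborel) = ennreal (u powr (s - 1) * exp (- u) * sqrt (\<nu> * pi / u))"
      by (simp add: nn_integral_cmult one)
    also have "u powr (s - 1) * exp (- u) * sqrt (\<nu> * pi / u) =
        sqrt (\<nu> * pi) * (u powr (s - 1) * u powr (- 1 / 2) * exp (- u))"
      using True by (simp add: real_sqrt_divide powr_minus powr_half_sqrt field_simps)
    also have "u powr (s - 1) * u powr (- 1 / 2) = u powr (\<nu> / 2 - 1)"
      unfolding powr_add[symmetric] by (rule arg_cong[where f = "\<lambda>r. u powr r"]) (simp add: s_def field_simps)
    finally show ?thesis using True \<nu> by (simp add: ennreal_mult)
  qed
  have "ennreal (Gamma s) * (\<integral>\<^sup>+t. ennreal ((1 + t\<^sup>2 / \<nu>) powr (- s)) \<partial>lborel) =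
      (\<integral>\<^sup>+t. (\<integral>\<^sup>+u. g u t \<partial>lborel) \<partial>lborel)"
    using Gamma_pos by (subst nn_integral_cmult[symmetric]) (auto simp: u_int ennreal_mult)
  also have "\<dots> = (\<integral>\<^sup>+u. (\<integral>\<^sup>+t. g u t \<partial>lborel) \<partial>lborel)"
    by (rule lborel_pair.Fubini') (simp add: g_def)
  also have "\<dots> = ennreal (sqrt (\<nu> * pi)) * ennreal (Gamma (\<nu> / 2))"
    unfolding t_int using \<nu> by (subst nn_integral_cmult) (auto simp: Gamma_int)
  finally have e: "ennreal (Gamma s) * (\<integral>\<^sup>+t. ennreal ((1 + t\<^sup>2 / \<nu>) powr (- s)) \<partial>lborel) =
      ennreal (sqrt (\<nu> * pi)) * ennreal (Gamma (\<nu> / 2))" .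
  have "(\<integral>\<^sup>+t. ennreal ((1 + t\<^sup>2 / \<nu>) powr (- s)) \<partial>lborel) =
      ennreal (1 / Gamma s) * (ennreal (Gamma s) * (\<integral>\<^sup>+t. ennreal ((1 + t\<^sup>2 / \<nu>) powr (- s)) \<partial>lborel))"
    using Gamma_pos by (simp add: mult.assoc[symmetric] ennreal_mult[symmetric])
  also have "\<dots> = ennreal (sqrt (\<nu> * pi) * Gamma (\<nu> / 2) / Gamma s)"
    unfolding e using Gamma_pos \<nu> Gamma_real_pos[of "\<nu> / 2"] by (simp add: ennreal_mult[symmetric] mult_ac)
  finally show ?thesis by (simp only: s_def minus_divide_left)
qed

lemma student_density_pos: "\<nu> > 0 \<Longrightarrow> 0 < student_density \<nu> x"
  unfolding student_density_def
  by (intro mult_pos_pos divide_pos_pos Gamma_real_pos) (auto simp: add_pos_nonneg add_nonneg_eq_0_iff)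

lemma measurable_student_density[measurable]: "student_density \<nu> \<in> borel_measurable borel"
  unfolding student_density_def[abs_def] by measurable

definition student :: "real \<Rightarrow> real measure" where
  "student \<nu> = density lborel (\<lambda>x. ennreal (student_density \<nu> x))"

lemma real_distribution_student:
  assumes \<nu>: "\<nu> > 0"
  shows "real_distribution (student \<nu>)"
proof -
  let ?c = "Gamma ((\<nu> + 1) / 2) / (sqrt (\<nu> * pi) * Gamma (\<nu> / 2))"
  have pos: "Gamma ((\<nu> + 1) / 2) > 0" "Gamma (\<nu> / 2) > 0" "sqrt (\<nu> * pi) > 0"
    using \<nu> by (auto intro!: Gamma_real_pos)
  have c: "?c > 0" using pos by simp
  have "emeasure (student \<nu>) (space (student \<nu>)) = (\<integral>\<^sup>+x. ennreal (student_density \<nu> x) \<partial>lborel)"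
    by (simp add: student_def emeasure_density)
  also have "\<dots> = (\<integral>\<^sup>+x. ennreal ?c * ennreal ((1 + x\<^sup>2 / \<nu>) powr (- (\<nu> + 1) / 2)) \<partial>lborel)"
    using c by (intro nn_integral_cong) (simp add: student_density_def ennreal_mult[symmetric] minus_divide_left)
  also have "\<dots> = ennreal ?c * ennreal (sqrt (\<nu> * pi) * Gamma (\<nu> / 2) / Gamma ((\<nu> + 1) / 2))"
    unfolding nn_integral_student_kernel[OF \<nu>, symmetric] by (rule nn_integral_cmult) measurable
  also have "\<dots> = ennreal (?c * (sqrt (\<nu> * pi) * Gamma (\<nu> / 2) / Gamma ((\<nu> + 1) / 2)))"
    using c pos by (intro ennreal_mult[symmetric]) auto
  also have "?c * (sqrt (\<nu> * pi) * Gamma (\<nu> / 2) / Gamma ((\<nu> + 1) / 2)) = 1"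
  proof -
    have cancel: "x / y * (y / x) = 1" if "x > 0" "y > 0" for x y :: real using that by simp
    show ?thesis by (rule cancel[OF pos(1) mult_pos_pos[OF pos(3,2)]])
  qed
  finally have "prob_space (student \<nu>)" by (intro prob_spaceI) simp
  then show ?thesis
    by (simp add: real_distribution_def real_distribution_axioms_def student_def)
qed

lemma positive_density_cdf:
  fixes f :: "real \<Rightarrow> real"
  assumes f[measurable]: "f \<in> borel_measurable borel" and pos: "\<And>x. 0 < f x"
    and D: "real_distribution D" and D_def: "D = density lborel (\<lambda>x. ennreal (f x))"
  shows "continuous_on UNIV (cdf D)" "strict_mono (cdf D)" "\<And>x. cdf D x < 1"
proof -
  interpret real_distribution D by (rule D)
  have pt: "measure D {x} = 0" for x
  proof -
    have "emeasure D {x} = 0"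
      unfolding D_def by (subst emeasure_density) (auto simp: nn_integral_0_iff_AE intro!: AE_I[of _ _ "{x}"])
    then show ?thesis by (simp add: measure_def)
  qed
  then show "continuous_on UNIV (cdf D)"
    by (simp add: continuous_on_eq_continuous_at isCont_cdf)
  show sm: "strict_mono (cdf D)"
  proof (rule strict_monoI)
    fix a b :: real assume ab: "a < b"
    have "emeasure D {a<..b} \<noteq> 0"
    proof
      assume "emeasure D {a<..b} = 0"
      then have "AE x in lborel. x \<notin> {a<..b}"
        unfolding D_def using pos
        by (subst (asm) emeasure_density)
          (auto simp: nn_integral_0_iff_AE less_le split: split_indicator_asm elim!: eventually_mono)
      then have "emeasure lborel {a<..b} = 0"
        by (subst (asm) AE_iff_measurable[of "{a<..b}"]) auto
      with ab show False by simp
    qed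
    then have "measure D {a<..b} > 0"
      by (simp add: emeasure_eq_measure zero_less_measure_iff)
    then show "cdf D a < cdf D b" using cdf_diff_eq[OF ab] by simp
  qed
  show "cdf D x < 1" for x
    using strict_monoD[OF sm, of x "x + 1"] cdf_bounded_prob[of "x + 1"] by simp
qed

text \<open>
  The probability integral transform above the level \<open>c\<close>. For \<open>s = 0\<close> the event is empty, as tails
  are positive. Otherwise, by continuity, there is a point \<open>x \<ge> c\<close> whose
  tail is the prescribed fraction of the tail at \<open>c\<close>, and by monotonicity the event is \<open>{x..}\<close> up to a
  null set.
\<close>

lemma emeasure_upper_tail_fraction:
  fixes D :: "real measure"
  assumes D: "real_distribution D" and cont: "continuous_on UNIV (cdf D)"
    and mono: "strict_mono (cdf D)" and le: "\<And>x. cdf D x < 1" and s: "0 \<le> s" "s \<le> 1"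
  shows "emeasure D {t. c < t \<and> 1 - cdf D t \<le> s * (1 - cdf D c)} = ennreal (s * (1 - cdf D c))"
proof (cases "s = 0")
  case True
  have empty: "{t. c < t \<and> 1 - cdf D t \<le> s * (1 - cdf D c)} = {}"
    using le True by (auto simp: not_le)
  show ?thesis unfolding empty unfolding True by simp
next
  case False
  interpret real_distribution D by (rule D)
  let ?y = "1 - s * (1 - cdf D c)"
  have pos: "0 < s * (1 - cdf D c)" using False s le[of c] by simp
  have "s * (1 - cdf D c) \<le> 1 * (1 - cdf D c)"
    using s le[of c] by (intro mult_right_mono) auto
  then have low: "cdf D c \<le> ?y" by simp
  have "eventually (\<lambda>x. ?y < cdf D x) at_top"
    using order_tendstoD(1)[OF cdf_lim_at_top_prob, of ?y] pos by simp
  then have "eventually (\<lambda>x. ?y < cdf D x \<and> c \<le> x) at_top"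
    using eventually_ge_at_top[of c] by eventually_elim simp
  then obtain d where d: "c \<le> d" "?y < cdf D d"
    using eventually_happens'[OF trivial_limit_at_top_linorder] by blast
  obtain x where x: "c \<le> x" "cdf D x = ?y"
    using IVT'[of "cdf D" c ?y d] low d continuous_on_subset[OF cont] by auto
  have "{t. c < t \<and> 1 - cdf D t \<le> s * (1 - cdf D c)} = {t. c < t \<and> x \<le> t}"
  proof -
    have "s * (1 - cdf D c) = 1 - cdf D x" using x(2) by simp
    then show ?thesis using strict_mono_less_eq[OF mono, of x] by simp
  qed
  moreover have "emeasure D {t. c < t \<and> x \<le> t} = emeasure D {x<..}"
  proof (rule emeasure_eq_AE)
    have "measure D {x} = 0"
      using cont by (simp add: isCont_cdf[symmetric] continuous_on_eq_continuous_at)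
    then have "AE t in D. t \<noteq> x"
      by (intro AE_I[of _ _ "{x}"]) (auto simp: emeasure_eq_measure)
    then show "AE t in D. t \<in> {t. c < t \<and> x \<le> t} \<longleftrightarrow> t \<in> {x<..}"
      by (rule AE_mp, intro AE_I2) (use x(1) in auto)
    have "{t. c < t \<and> x \<le> t} = {c<..} \<inter> {x..}" by auto
    then show "{t. c < t \<and> x \<le> t} \<in> sets D" by simp
  qed simp
  moreover have "measure D {x<..} = 1 - cdf D x"
    using prob_compl[of "{..x}"] by (simp add: cdf_def Compl_eq_Diff_UNIV[symmetric])
  ultimately show ?thesis by (simp add: emeasure_eq_measure x(2))
qed

section \<open>Conditional uniformity given a direction\<close>

lemma student_cdf_eq: "student_cdf \<nu> = cdf (student \<nu>)"
  by (simp add: student_cdf_def student_def fun_eq_iff)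

definition gaussian_coords :: "nat \<Rightarrow> (nat \<Rightarrow> real) measure" where
  "gaussian_coords n = Pi\<^sub>M {..<n} (\<lambda>_. std_normal_distribution)"

lemma gaussian_coords_density:
  "gaussian_coords n = density (lebesgue_coords n) (\<lambda>z. ennreal (gauss n z))"
  by (simp add: gaussian_coords_def PiM_std_normal_eq_density)

lemma sets_gaussian_coords[measurable_cong]: "sets (gaussian_coords n) = sets (lebesgue_coords n)"
  by (simp add: gaussian_coords_density)

lemma space_gaussian_coords: "space (gaussian_coords n) = space (lebesgue_coords n)"
  by (simp add: gaussian_coords_density)

lemma prob_space_gaussian_coords: "prob_space (gaussian_coords n)"
  unfolding gaussian_coords_def by (intro prob_space_PiM prob_space_normal_density) simp

text \<open>
  The event fixes a lower threshold \<open>L\<close> that depends on the orthogonal component only. In the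
  coordinates of \<open>gauss_polar\<close> the inner integral over \<open>t\<close> is a Student tail beyond \<open>T2 z\<close>, and by
  \<open>emeasure_upper_tail_fraction\<close> restricting the ratio of tails to be at most \<open>s\<close> multiplies it by
  \<open>s\<close>. The outer integral is the same with and without this restriction.
\<close>

lemma truncated_student_uniform:
  fixes L :: "(nat \<Rightarrow> real) \<Rightarrow> real"
  assumes n: "n \<ge> 2" and w: "ip n w w = 1"
    and L[measurable]: "L \<in> borel_measurable (lebesgue_coords n)"
    and L_slide: "\<And>x z. L (slide n w x z) = L z"
    and L_dilate: "\<And>a z. 0 < a \<Longrightarrow> L (dilate n a z) = a * L z"
    and s: "0 \<le> s" "s \<le> 1"
  defines "\<nu> \<equiv> real n - 1"
  defines "G \<equiv> \<lambda>t. 1 - student_cdf \<nu> t"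
  defines "T1 \<equiv> \<lambda>z. sqrt \<nu> * ip n w z / perp n w z" and "T2 \<equiv> \<lambda>z. sqrt \<nu> * L z / perp n w z"
  shows "measure (gaussian_coords n)
      {z \<in> space (gaussian_coords n). perp n w z > 0 \<and> L z < ip n w z \<and> G (T1 z) \<le> s * G (T2 z)} =
    s * measure (gaussian_coords n) {z \<in> space (gaussian_coords n). perp n w z > 0 \<and> L z < ip n w z}"
proof -
  let ?L = "lebesgue_coords n" and ?\<Gamma> = "gaussian_coords n" and ?R = "perp n w"
  have \<nu>: "\<nu> > 0" using n by (simp add: \<nu>_def)
  interpret prob_space ?\<Gamma> by (rule prob_space_gaussian_coords)
  note D = real_distribution_student[OF \<nu>]
  interpret D: real_distribution "student \<nu>" by (rule D)
  note cdf = positive_density_cdf[OF measurable_student_density student_density_pos[OF \<nu>] D student_def]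
  have G_eq: "G t = 1 - cdf (student \<nu>) t" for t by (simp add: G_def student_cdf_eq)
  have G_antimono: "G t \<le> G u \<longleftrightarrow> u \<le> t" for t u
    using strict_mono_less_eq[OF cdf(2), of u t] by (simp add: G_eq)
  have G_pos: "G t > 0" for t using cdf(3)[of t] by (simp add: G_eq)
  have G[measurable]: "G \<in> borel_measurable borel"
    unfolding G_def student_cdf_eq
    using borel_measurable_continuous_onI[OF cdf(1)] by measurable
  have T[measurable]: "T1 \<in> borel_measurable ?L" "T2 \<in> borel_measurable ?L"
    unfolding T1_def[abs_def] T2_def[abs_def] by measurable
  have GT[measurable]: "(\<lambda>z. G (T1 z)) \<in> borel_measurable ?L" "(\<lambda>z. G (T2 z)) \<in> borel_measurable ?L"
    using measurable_compose[OF T(1) G] measurable_compose[OF T(2) G] by simp_all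
  define c where "c = Gamma ((\<nu> + 1) / 2) / (sqrt (\<nu> * pi) * Gamma (\<nu> / 2))"
  have c: "c > 0" using \<nu> by (auto simp: c_def intro!: divide_pos_pos mult_pos_pos Gamma_real_pos)
  \<comment> \<open>\<open>K\<close> is the probability of the selection event, as the case \<open>s = 1\<close> of \<open>key\<close> shows.\<close>
  define K where "K = (\<integral>\<^sup>+z. ennreal (std_normal_density (ip n w z)) *
      (ennreal ((1 / sqrt (2 * pi)) ^ n * (?R z / sqrt \<nu>) * exp (- (?R z)\<^sup>2 / 2)) *
         ennreal (G (T2 z) / c)) \<partial>?L)"
  have key: "emeasure ?\<Gamma> {z \<in> space ?\<Gamma>. ?R z > 0 \<and> L z < ip n w z \<and> G (T1 z) \<le> s * G (T2 z)} = ennreal s * K"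
    if s: "0 \<le> s" "s \<le> 1" for s
  proof -
    define H :: "real \<Rightarrow> (nat \<Rightarrow> real) \<Rightarrow> ennreal" where
      "H = (\<lambda>t z. if T2 z < t \<and> G t \<le> s * G (T2 z) then 1 else 0)"
    have H[measurable]: "(\<lambda>(t, z). H t z) \<in> borel_measurable (lborel \<Otimes>\<^sub>M ?L)"
      unfolding H_def split_beta' by measurable
    have T2_slide: "T2 (slide n w x z) = T2 z" for x z by (simp add: T2_def L_slide perp_slide[OF w])
    have T2_dilate: "T2 (dilate n a z) = T2 z" if "0 < a" for a z
      using that by (simp add: T2_def L_dilate perp_dilate)
    have "{z \<in> space ?L. G (T1 z) \<le> s * G (T2 z)} \<in> sets ?L"
      by (rule borel_measurable_le[OF GT(1) borel_measurable_times[OF borel_measurable_const GT(2)]])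
    then have [measurable]: "Measurable.pred ?L (\<lambda>z. G (T1 z) \<le> s * G (T2 z))"
      by (simp add: pred_def)
    have "emeasure ?\<Gamma> {z \<in> space ?\<Gamma>. ?R z > 0 \<and> L z < ip n w z \<and> G (T1 z) \<le> s * G (T2 z)} =
       (\<integral>\<^sup>+z. ennreal (gauss n z) *
          indicator {z \<in> space ?L. ?R z > 0 \<and> L z < ip n w z \<and> G (T1 z) \<le> s * G (T2 z)} z \<partial>?L)"
      unfolding space_gaussian_coords unfolding gaussian_coords_density
      by (rule emeasure_density) measurable
    also have "\<dots> = (\<integral>\<^sup>+z. (if ?R z > 0 then ennreal (gauss n z) * H (T1 z) z else 0) \<partial>?L)"
    proof (rule nn_integral_cong)
      fix z assume z: "z \<in> space ?L"
      have "L z < ip n w z \<longleftrightarrow> T2 z < T1 z" if "?R z > 0"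
        using that \<nu> by (simp add: T1_def T2_def divide_less_cancel)
      then show "ennreal (gauss n z) *
          indicator {z \<in> space ?L. ?R z > 0 \<and> L z < ip n w z \<and> G (T1 z) \<le> s * G (T2 z)} z =
        (if ?R z > 0 then ennreal (gauss n z) * H (T1 z) z else 0)"
        using z by (auto simp: H_def split: split_indicator)
    qed
    also have "\<dots> = (\<integral>\<^sup>+z. ennreal (std_normal_density (ip n w z)) *
            (ennreal ((1 / sqrt (2 * pi)) ^ n * (?R z / sqrt \<nu>) * exp (- (?R z)\<^sup>2 / 2)) *
             (\<integral>\<^sup>+t. ennreal ((1 + t\<^sup>2 / \<nu>) powr (- (\<nu> + 1) / 2)) * H t z \<partial>lborel)) \<partial>?L)"
      unfolding T1_def \<nu>_def
      by (rule gauss_polar[OF n w H]) (simp_all add: H_def T2_slide T2_dilate)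
    also have "\<dots> = (\<integral>\<^sup>+z. ennreal s * (ennreal (std_normal_density (ip n w z)) *
            (ennreal ((1 / sqrt (2 * pi)) ^ n * (?R z / sqrt \<nu>) * exp (- (?R z)\<^sup>2 / 2)) *
             ennreal (G (T2 z) / c))) \<partial>?L)"
    proof (rule nn_integral_cong)
      fix z assume z: "z \<in> space ?L"
      have [measurable]: "(\<lambda>t. H t z) \<in> borel_measurable borel"
        unfolding H_def by measurable
      have "(\<integral>\<^sup>+t. ennreal ((1 + t\<^sup>2 / \<nu>) powr (- (\<nu> + 1) / 2)) * H t z \<partial>lborel) =
          (\<integral>\<^sup>+t. ennreal (1 / c) * (ennreal (student_density \<nu> t) * H t z) \<partial>lborel)"
      proof (rule nn_integral_cong)
        fix t
        have "(1 + t\<^sup>2 / \<nu>) powr (- (\<nu> + 1) / 2) = 1 / c * student_density \<nu> t"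
          using c unfolding student_density_def c_def[symmetric] by (simp only: minus_divide_left) simp
        then show "ennreal ((1 + t\<^sup>2 / \<nu>) powr (- (\<nu> + 1) / 2)) * H t z =
            ennreal (1 / c) * (ennreal (student_density \<nu> t) * H t z)"
          using c student_density_pos[OF \<nu>, of t]
          by (simp add: ennreal_mult[symmetric] mult.assoc[symmetric])
      qed
      also have "\<dots> = ennreal (1 / c) * (\<integral>\<^sup>+t. ennreal (student_density \<nu> t) * H t z \<partial>lborel)"
        by (rule nn_integral_cmult) measurable
      also have "(\<integral>\<^sup>+t. ennreal (student_density \<nu> t) * H t z \<partial>lborel) =
          emeasure (student \<nu>) {t. T2 z < t \<and> 1 - cdf (student \<nu>) t \<le> s * (1 - cdf (student \<nu>) (T2 z))}"
      proof -
        have "{t. T2 z < t \<and> G t \<le> s * G (T2 z)} \<in> sets lborel" by measurable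
        then show ?thesis
          unfolding G_eq[symmetric] unfolding student_def
          by (subst emeasure_density) (auto simp: H_def intro!: nn_integral_cong split: split_indicator)
      qed
      also have "\<dots> = ennreal (s * G (T2 z))"
        unfolding G_eq by (rule emeasure_upper_tail_fraction[OF D cdf s])
      finally have "(\<integral>\<^sup>+t. ennreal ((1 + t\<^sup>2 / \<nu>) powr (- (\<nu> + 1) / 2)) * H t z \<partial>lborel) =
          ennreal s * ennreal (G (T2 z) / c)"
        using c s(1) G_pos[of "T2 z"] by (simp add: ennreal_mult[symmetric])
      then show "ennreal (std_normal_density (ip n w z)) *
            (ennreal ((1 / sqrt (2 * pi)) ^ n * (?R z / sqrt \<nu>) * exp (- (?R z)\<^sup>2 / 2)) *
             (\<integral>\<^sup>+t. ennreal ((1 + t\<^sup>2 / \<nu>) powr (- (\<nu> + 1) / 2)) * H t z \<partial>lborel)) =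
          ennreal s * (ennreal (std_normal_density (ip n w z)) *
            (ennreal ((1 / sqrt (2 * pi)) ^ n * (?R z / sqrt \<nu>) * exp (- (?R z)\<^sup>2 / 2)) *
             ennreal (G (T2 z) / c)))"
        by (simp only: mult_ac)
    qed
    also have "\<dots> = ennreal s * K"
      unfolding K_def by (rule nn_integral_cmult) measurable
    finally show ?thesis .
  qed
  have "{z \<in> space ?\<Gamma>. ?R z > 0 \<and> L z < ip n w z \<and> G (T1 z) \<le> 1 * G (T2 z)} =
      {z \<in> space ?\<Gamma>. ?R z > 0 \<and> L z < ip n w z}"
    using \<nu> by (auto simp: G_antimono T1_def T2_def divide_right_mono)
  then have K: "emeasure ?\<Gamma> {z \<in> space ?\<Gamma>. ?R z > 0 \<and> L z < ip n w z} = K"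
    using key[of 1] by simp
  then have "K = ennreal (measure ?\<Gamma> {z \<in> space ?\<Gamma>. ?R z > 0 \<and> L z < ip n w z})"
    by (simp add: emeasure_eq_measure)
  then show ?thesis
    using key[OF s] s(1) by (simp add: emeasure_eq_measure ennreal_mult[symmetric])
qed

section \<open>The maximum over finitely many directions\<close>

text \<open>
  A line transversal to the hyperplane meets it in one point.
\<close>

lemma AE_hyperplane_null:
  assumes v: "ip n v v = 1" and uv: "ip n u v \<noteq> 0"
  shows "AE z in lebesgue_coords n. ip n u z \<noteq> 0"
proof -
  let ?G = "\<lambda>z. indicator {0} (ip n u z) :: ennreal"
  have "(\<integral>\<^sup>+z. ?G z \<partial>lebesgue_coords n) =
    (\<integral>\<^sup>+z. ennreal (std_normal_density (ip n v z)) * (\<integral>\<^sup>+x. ?G (slide n v x z) \<partial>lborel) \<partial>lebesgue_coords n)"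
    by (rule nn_integral_along_lines[OF v _ nn_integral_std_normal_density]) measurable
  also have "\<dots> = 0"
  proof -
    have "(\<integral>\<^sup>+x. ?G (slide n v x z) \<partial>lborel) = 0" for z
    proof -
      have "(\<integral>\<^sup>+x. ?G (slide n v x z) \<partial>lborel) = (\<integral>\<^sup>+x. indicator {- ip n u z / ip n u v} x \<partial>lborel)"
        using uv by (intro nn_integral_cong) (auto simp: ip_slide field_simps split: split_indicator)
      then show ?thesis by simp
    qed
    then show ?thesis by simp
  qed
  finally have "AE z in lebesgue_coords n. ?G z = 0"
    by (subst (asm) nn_integral_0_iff_AE) auto
  then show ?thesis by eventually_elim (auto split: split_indicator_asm)
qed

lemma ip_diff_left: "ip n (\<lambda>i. v i - c * w i) z = ip n v z - c * ip n w z"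
  by (simp add: ip_def sum_subtractf sum_distrib_left algebra_simps)

text \<open>
  If the orthogonal component vanishes, \<open>z\<close> is a multiple of \<open>w\<close>.
\<close>

lemma perp_eq_0_ip:
  assumes w: "ip n w w = 1" and "perp n w z = 0"
  shows "ip n v z = ip n v w * ip n w z"
proof -
  define r where "r = slide n w (- ip n w z) z"
  have "ip n r r = (perp n w z)\<^sup>2"
    unfolding r_def ip_slide_slide w perp_square[OF w] by (simp add: power2_eq_square)
  then have "(\<Sum>i<n. r i * r i) = 0" using assms(2) by (simp add: ip_def)
  then have "\<forall>i<n. r i = 0"
    by (subst (asm) sum_nonneg_eq_0_iff) auto
  then have "ip n v r = 0" by (simp add: ip_def)
  then show ?thesis by (simp add: r_def ip_slide)
qed

text \<open>
  In dimension at least 2 some axis \<open>e\<^sub>j\<close> is not parallel to \<open>w\<close>; vectors parallel to \<open>w\<close> lie in the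
  hyperplane orthogonal to \<open>e\<^sub>j - w\<^sub>j w\<close>.
\<close>

lemma AE_perp_pos:
  assumes n: "n \<ge> 2" and w: "ip n w w = 1"
  shows "AE z in lebesgue_coords n. perp n w z > 0"
proof -
  have "(\<Sum>i<2. w i * w i) \<le> ip n w w"
    unfolding ip_def using n by (intro sum_mono2) auto
  then have "w 0 * w 0 + w 1 * w 1 \<le> 1" using w by (simp add: numeral_2_eq_2)
  then have "w 0 * w 0 < 1 \<or> w 1 * w 1 < 1" by linarith
  moreover have "0 < n" "1 < n" using n by auto
  ultimately obtain j where j: "j < n" "w j * w j < 1" by blast
  let ?e = "\<lambda>i. if i = j then 1 else 0 :: real"
  have e: "ip n ?e v = v j" for v using j by (simp add: ip_def if_distrib[of "\<lambda>x. x * _"] cong: if_cong)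
  let ?u = "\<lambda>i. ?e i - w j * w i"
  have "ip n ?u ?e \<noteq> 0"
    using j e[of w] e[of ?e] unfolding ip_diff_left by (simp add: ip_commute[of n w])
  then have "AE z in lebesgue_coords n. ip n ?u z \<noteq> 0"
    by (intro AE_hyperplane_null[of n ?e]) (simp add: e)
  then show ?thesis
  proof eventually_elim
    case (elim z)
    then have "perp n w z \<noteq> 0"
      using perp_eq_0_ip[OF w, of z ?e] by (auto simp: ip_diff_left e)
    then show ?case using perp_nonneg[OF w, of z] by simp
  qed
qed

text \<open>
  The second knot when \<open>w\<close> maximises \<open>v \<bullet> z\<close> over \<open>V\<close>: the largest value of \<open>w \<bullet> z\<close>, the orthogonal
  component being kept fixed, at which another element of \<open>V\<close> ties with \<open>w\<close>.
\<close>

definition runner_up :: "nat \<Rightarrow> (nat \<Rightarrow> real) set \<Rightarrow> (nat \<Rightarrow> real) \<Rightarrow> (nat \<Rightarrow> real) \<Rightarrow> real" where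
  "runner_up n V w z = Max ((\<lambda>v. (ip n v z - ip n v w * ip n w z) / (1 - ip n v w)) ` (V - {w}))"

text \<open>
  Split the space according to the maximiser \<open>w\<close> of \<open>v \<bullet> z\<close> over \<open>V\<close>. The maximiser is \<open>w\<close> exactly if
  \<open>w \<bullet> z\<close> exceeds \<open>runner_up n V w z\<close>, a threshold determined by the component orthogonal to \<open>w\<close>, so
  \<open>truncated_student_uniform\<close> applies on each piece. Ties have probability 0, so the pieces exhaust the
  space and their probabilities sum to 1.
\<close>

theorem spacing_uniform:
  assumes n: "n \<ge> 2" and V: "finite V" "V \<noteq> {}" and others: "\<And>w. w \<in> V \<Longrightarrow> V - {w} \<noteq> {}"
    and unit: "\<And>w. w \<in> V \<Longrightarrow> ip n w w = 1"
    and distinct: "\<And>v w. v \<in> V \<Longrightarrow> w \<in> V \<Longrightarrow> v \<noteq> w \<Longrightarrow> ip n v w < 1"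
    and \<tau>[measurable]: "\<tau> \<in> borel_measurable (lebesgue_coords n)"
    and \<tau>_eq: "\<And>w z. w \<in> V \<Longrightarrow> z \<in> space (lebesgue_coords n) \<Longrightarrow> perp n w z > 0 \<Longrightarrow>
        (\<And>v. v \<in> V - {w} \<Longrightarrow> ip n v z < ip n w z) \<Longrightarrow>
        \<tau> z = (1 - student_cdf (real n - 1) (sqrt (real n - 1) * ip n w z / perp n w z)) /
              (1 - student_cdf (real n - 1) (sqrt (real n - 1) * runner_up n V w z / perp n w z))"
    and s: "0 \<le> s" "s \<le> 1"
  shows "measure (gaussian_coords n) {z \<in> space (gaussian_coords n). \<tau> z \<le> s} = s"
proof -
  let ?L = "lebesgue_coords n" and ?\<Gamma> = "gaussian_coords n" and ?\<nu> = "real n - 1"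
  let ?G = "\<lambda>t. 1 - student_cdf ?\<nu> t"
  interpret prob_space ?\<Gamma> by (rule prob_space_gaussian_coords)
  define A where "A w = {z \<in> space ?\<Gamma>. perp n w z > 0 \<and> runner_up n V w z < ip n w z}" for w
  have G_pos: "?G t > 0" for t
    using positive_density_cdf(3)[OF measurable_student_density student_density_pos real_distribution_student student_def, of ?\<nu> t] n
    by (simp add: student_cdf_eq)
  have less_iff: "runner_up n V w z < ip n w z \<longleftrightarrow> (\<forall>v\<in>V - {w}. ip n v z < ip n w z)" if "w \<in> V" for w z
  proof -
    have "(ip n v z - ip n v w * ip n w z) / (1 - ip n v w) < ip n w z \<longleftrightarrow> ip n v z < ip n w z"
      if "v \<in> V - {w}" for v
      using distinct[of v w] that \<open>w \<in> V\<close> by (simp add: pos_divide_less_eq algebra_simps)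
    then show ?thesis
      unfolding runner_up_def using V others[OF that] by (subst Max_less_iff) auto
  qed
  have L[measurable]: "runner_up n V w \<in> borel_measurable ?L" for w
    unfolding runner_up_def[abs_def] using V by (intro borel_measurable_Max) auto
  have L_slide: "runner_up n V w (slide n w x z) = runner_up n V w z" if "w \<in> V" for w x z
    using unit[OF that] by (simp add: runner_up_def ip_slide algebra_simps)
  have L_dilate: "runner_up n V w (dilate n a z) = a * runner_up n V w z" if "w \<in> V" "0 < a" for w a z
  proof -
    have "a * runner_up n V w z =
      Max ((*) a ` (\<lambda>v. (ip n v z - ip n v w * ip n w z) / (1 - ip n v w)) ` (V - {w}))"
      unfolding runner_up_def using V others[OF that(1)] that(2)
      by (intro mono_Max_commute) (auto simp: mono_def)
    then show ?thesis
      by (simp add: runner_up_def ip_dilate image_image right_diff_distrib mult_ac)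
  qed
  have A[measurable]: "A w \<in> sets ?\<Gamma>" for w
    unfolding A_def by measurable
  have disj: "disjoint_family_on A V"
    unfolding disjoint_family_on_def
  proof (intro ballI impI)
    fix v w assume vw: "v \<in> V" "w \<in> V" "v \<noteq> w"
    show "A v \<inter> A w = {}"
    proof (rule equals0I)
      fix z assume "z \<in> A v \<inter> A w"
      then have "\<forall>u\<in>V - {v}. ip n u z < ip n v z" "\<forall>u\<in>V - {w}. ip n u z < ip n w z"
        using less_iff[OF vw(1), of z] less_iff[OF vw(2), of z] by (simp_all add: A_def)
      then have "ip n w z < ip n v z" "ip n v z < ip n w z"
        using vw by simp_all
      then show False by simp
    qed
  qed
  have cover: "AE z in ?\<Gamma>. z \<in> (\<Union>w\<in>V. A w)"
  proof -
    have "AE z in ?L. \<forall>w\<in>V. perp n w z > 0 \<and> (\<forall>v\<in>V. v \<noteq> w \<longrightarrow> ip n v z \<noteq> ip n w z)"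
    proof (intro AE_finite_allI[OF V(1)] AE_conjI AE_perp_pos[OF n unit])
      fix v w assume vw: "w \<in> V" "v \<in> V"
      show "AE z in ?L. v \<noteq> w \<longrightarrow> ip n v z \<noteq> ip n w z"
      proof (cases "v = w")
        case False
        let ?u = "\<lambda>i. v i - 1 * w i"
        have "ip n ?u v \<noteq> 0"
          using distinct[of v w] vw False unit[of v] unfolding ip_diff_left
          by (simp add: ip_commute[of n w])
        then have "AE z in ?L. ip n ?u z \<noteq> 0"
          by (intro AE_hyperplane_null[of n v] unit vw)
        then show ?thesis
            by eventually_elim (simp add: ip_diff_left[of n v 1 w, simplified])
      qed simp
    qed
    then have "AE z in ?\<Gamma>. \<forall>w\<in>V. perp n w z > 0 \<and> (\<forall>v\<in>V. v \<noteq> w \<longrightarrow> ip n v z \<noteq> ip n w z)"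
      unfolding gaussian_coords_density by (subst AE_density) (auto elim: eventually_mono)
    then show ?thesis
    proof (rule AE_mp, intro AE_I2 impI)
      fix z assume z: "z \<in> space ?\<Gamma>"
        and *: "\<forall>w\<in>V. perp n w z > 0 \<and> (\<forall>v\<in>V. v \<noteq> w \<longrightarrow> ip n v z \<noteq> ip n w z)"
      obtain w where w: "w \<in> V" "ip n w z = Max ((\<lambda>v. ip n v z) ` V)"
        using Max_in[of "(\<lambda>v. ip n v z) ` V"] V by fastforce
      have "ip n v z < ip n w z" if "v \<in> V - {w}" for v
      proof -
        have "ip n v z \<le> ip n w z" using that V unfolding w(2) by (intro Max_ge) auto
        moreover have "ip n v z \<noteq> ip n w z" using that * w(1) by blast
        ultimately show ?thesis by simp
      qed
      then have "z \<in> A w" using z * w(1) less_iff[OF w(1)] by (simp add: A_def)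
      then show "z \<in> (\<Union>w\<in>V. A w)" using w(1) by blast
    qed
  qed
  have part: "measure ?\<Gamma> (A w \<inter> {z \<in> space ?\<Gamma>. \<tau> z \<le> s}) = s * measure ?\<Gamma> (A w)" if w: "w \<in> V" for w
  proof -
    have "A w \<inter> {z \<in> space ?\<Gamma>. \<tau> z \<le> s} =
      {z \<in> space ?\<Gamma>. perp n w z > 0 \<and> runner_up n V w z < ip n w z \<and>
         ?G (sqrt ?\<nu> * ip n w z / perp n w z) \<le> s * ?G (sqrt ?\<nu> * runner_up n V w z / perp n w z)}"
      using \<tau>_eq[OF w] less_iff[OF w] G_pos
      by (auto simp: A_def space_gaussian_coords pos_divide_le_eq)
    then show ?thesis
      unfolding A_def
      using truncated_student_uniform[OF n unit[OF w] L L_slide[OF w] L_dilate[OF w] s] by simp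
  qed
  have "measure ?\<Gamma> {z \<in> space ?\<Gamma>. \<tau> z \<le> s} = measure ?\<Gamma> (\<Union>w\<in>V. A w \<inter> {z \<in> space ?\<Gamma>. \<tau> z \<le> s})"
  proof (rule finite_measure_eq_AE)
    show "AE z in ?\<Gamma>. z \<in> {z \<in> space ?\<Gamma>. \<tau> z \<le> s} \<longleftrightarrow>
        z \<in> (\<Union>w\<in>V. A w \<inter> {z \<in> space ?\<Gamma>. \<tau> z \<le> s})"
      using cover by eventually_elim auto
    have sub: "{z \<in> space ?\<Gamma>. \<tau> z \<le> s} \<in> sets ?\<Gamma>" by measurable
    then show "(\<Union>w\<in>V. A w \<inter> {z \<in> space ?\<Gamma>. \<tau> z \<le> s}) \<in> sets ?\<Gamma>"
      using V by (intro sets.finite_UN sets.Int A) auto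
  qed measurable
  also have "\<dots> = (\<Sum>w\<in>V. measure ?\<Gamma> (A w \<inter> {z \<in> space ?\<Gamma>. \<tau> z \<le> s}))"
    using disj V by (intro finite_measure_finite_Union) (auto simp: disjoint_family_on_def)
  also have "\<dots> = s * (\<Sum>w\<in>V. measure ?\<Gamma> (A w))"
    by (simp add: part sum_distrib_left)
  also have "(\<Sum>w\<in>V. measure ?\<Gamma> (A w)) = measure ?\<Gamma> (\<Union>w\<in>V. A w)"
    using disj V by (intro finite_measure_finite_Union[symmetric]) auto
  also have "\<dots> = 1"
    using cover V by (intro prob_eq_1[THEN iffD2]) auto
  finally show ?thesis by simp
qed

section \<open>The statistic in coordinates\<close>

definition xcol :: "real mat \<Rightarrow> nat \<Rightarrow> nat \<Rightarrow> real" where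
  "xcol X j = (\<lambda>k. X $$ (k, j))"

text \<open>
  The statistic in explicit form, with the selected pair as a parameter: for a fixed pair it is a Borel
  function of the response.
\<close>

definition spacing_stat :: "nat \<Rightarrow> real mat \<Rightarrow> (nat \<Rightarrow> real) \<Rightarrow> nat \<times> real \<Rightarrow> real" where
  "spacing_stat n X v = (\<lambda>(i, \<epsilon>).
     let F = student_cdf (real n - 1); U = (\<lambda>j. ip n (xcol X j) v);
         R = (\<lambda>j. ip n (xcol X j) (xcol X i));
         s = sqrt (ip n v v - (U i)\<^sup>2) / sqrt (real n - 1);
         k = Max ((\<lambda>j. max ((U j - R j * U i) / (1 - \<epsilon> * R j))
                           ((- U j + R j * U i) / (1 + \<epsilon> * R j))) ` ({..<dim_col X} - {i}))
     in (1 - F (\<epsilon> * U i / s)) / (1 - F (k / s)))"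

definition maximisers :: "nat \<Rightarrow> real mat \<Rightarrow> (nat \<Rightarrow> real) \<Rightarrow> (nat \<times> real) set" where
  "maximisers n X v = {(i, \<epsilon>) \<in> {..<dim_col X} \<times> {- 1, 1}.
     \<forall>j<dim_col X. \<bar>ip n (xcol X j) v\<bar> \<le> \<epsilon> * ip n (xcol X i) v}"

lemma scalar_prod_vec: "dim_vec u = n \<Longrightarrow> u \<bullet> vec n v = ip n (\<lambda>k. u $ k) v"
  by (simp add: scalar_prod_def ip_def lessThan_atLeast0)

lemma corr_vec:
  assumes "X \<in> carrier_mat n p" "j < p"
  shows "corr X (vec n v) $ j = ip n (xcol X j) v"
  using assms by (simp add: corr_def scalar_prod_def ip_def xcol_def lessThan_atLeast0)

lemma gram_entry:
  assumes "X \<in> carrier_mat n p" "i < p" "j < p"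
  shows "gram X $$ (j, i) = ip n (xcol X j) (xcol X i)"
  using assms by (simp add: gram_def scalar_prod_def ip_def xcol_def lessThan_atLeast0)

lemma linf_norm_corr_iff:
  assumes X: "X \<in> carrier_mat n p" and i: "i < p" "\<epsilon> \<in> {- 1, 1}"
  shows "\<epsilon> * corr X (vec n v) $ i = linf_norm (corr X (vec n v)) \<longleftrightarrow>
    (\<forall>j<p. \<bar>ip n (xcol X j) v\<bar> \<le> \<epsilon> * ip n (xcol X i) v)"
proof -
  let ?U = "\<lambda>j. ip n (xcol X j) v"
  have dim: "dim_vec (corr X (vec n v)) = p" using X by (simp add: corr_def)
  have linf: "linf_norm (corr X (vec n v)) = Max ((\<lambda>j. \<bar>?U j\<bar>) ` {..<p})"
    unfolding linf_norm_def dim using X by (intro arg_cong[where f = Max] image_cong) (auto simp: corr_vec)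
  have ne: "(\<lambda>j. \<bar>?U j\<bar>) ` {..<p} \<noteq> {}" using i by auto
  have le: "\<epsilon> * ?U i \<le> \<bar>?U i\<bar>" using i by auto
  show ?thesis
    unfolding linf corr_vec[OF X i(1)]
  proof
    assume "\<epsilon> * ?U i = Max ((\<lambda>j. \<bar>?U j\<bar>) ` {..<p})"
    then show "\<forall>j<p. \<bar>?U j\<bar> \<le> \<epsilon> * ?U i" by simp
  next
    assume *: "\<forall>j<p. \<bar>?U j\<bar> \<le> \<epsilon> * ?U i"
    have "\<epsilon> * ?U i = \<bar>?U i\<bar>" using * i(1) le by (simp add: order_antisym)
    then show "\<epsilon> * ?U i = Max ((\<lambda>j. \<bar>?U j\<bar>) ` {..<p})"
      using * i(1) by (intro Max_eqI[symmetric]) auto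
  qed
qed

lemma lars_first_eq:
  assumes X: "X \<in> carrier_mat n p"
  shows "lars_first X (vec n v) = (SOME c. c \<in> maximisers n X v)"
proof -
  have "(case c of (i, \<epsilon>) \<Rightarrow> i < dim_col X \<and> \<epsilon> \<in> {- 1, 1} \<and>
      \<epsilon> * corr X (vec n v) $ i = linf_norm (corr X (vec n v))) \<longleftrightarrow> c \<in> maximisers n X v" for c
    using X linf_norm_corr_iff[OF X, of "fst c" "snd c" v] by (auto simp: maximisers_def split: prod.splits)
  then show ?thesis unfolding lars_first_def by (intro arg_cong[where f = Eps]) (simp add: fun_eq_iff)
qed

lemma maximisers_nonempty:
  assumes X: "X \<in> carrier_mat n p" and p: "p \<ge> 1"
  shows "maximisers n X v \<noteq> {}"
proof -
  let ?U = "\<lambda>j. ip n (xcol X j) v"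
  have ne: "(\<lambda>j. \<bar>?U j\<bar>) ` {..<p} \<noteq> {}" using p by (auto simp: lessThan_empty_iff)
  obtain i where i: "i < p" "\<bar>?U i\<bar> = Max ((\<lambda>j. \<bar>?U j\<bar>) ` {..<p})"
    using Max_in[OF _ ne] by fastforce
  have "\<bar>?U j\<bar> \<le> \<bar>?U i\<bar>" if "j < p" for j
    unfolding i(2) using that by (intro Max_ge) auto
  then have "(i, if ?U i \<ge> 0 then 1 else - 1) \<in> maximisers n X v"
    using i(1) X by (auto simp: maximisers_def)
  then show ?thesis by blast
qed

lemma lars_first_maximiser:
  assumes "X \<in> carrier_mat n p" "p \<ge> 1"
  shows "lars_first X (vec n v) \<in> maximisers n X v"
  unfolding lars_first_eq[OF assms(1)] using maximisers_nonempty[OF assms] by (simp add: some_in_eq)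

lemma t_spacing_eq:
  assumes X: "X \<in> carrier_mat n p" and p: "p \<ge> 1"
    and unit: "\<And>i. i < p \<Longrightarrow> l2_norm (col X i) = 1"
    and rk: "\<And>i. i < p \<Longrightarrow> vec_space.rank n (del_col X i) = n"
  shows "t_spacing X (vec n v) = spacing_stat n X v (lars_first X (vec n v))"
proof -
  obtain i \<epsilon> where c: "lars_first X (vec n v) = (i, \<epsilon>)" by (metis surj_pair)
  have i: "i < p" using lars_first_maximiser[OF X p, of v] X unfolding c by (auto simp: maximisers_def)
  have "col X i \<bullet> col X i = 1" using unit[OF i] by (simp add: l2_norm_def)
  then have sig: "sigma_hat X (vec n v) = sqrt (ip n v v - (ip n (xcol X i) v)\<^sup>2) / sqrt (real n - 1)"
    unfolding sigma_hat_def c using residual_norm[OF X i vec_carrier _ rk[OF i], of v] X i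
    by (simp add: scalar_prod_vec) (simp add: ip_def xcol_def)
  have k1: "lars_knot1 X (vec n v) = \<epsilon> * ip n (xcol X i) v"
    by (simp add: lars_knot1_def c corr_vec[OF X i])
  have k2: "lars_knot2 X (vec n v) = Max ((\<lambda>j. max
      ((ip n (xcol X j) v - ip n (xcol X j) (xcol X i) * ip n (xcol X i) v) / (1 - \<epsilon> * ip n (xcol X j) (xcol X i)))
      ((- ip n (xcol X j) v + ip n (xcol X j) (xcol X i) * ip n (xcol X i) v) / (1 + \<epsilon> * ip n (xcol X j) (xcol X i))))
         ` ({..<dim_col X} - {i}))"
    unfolding lars_knot2_def c Let_def split
    by (intro arg_cong[where f = Max] image_cong refl) (use X i in \<open>simp add: corr_vec gram_entry\<close>)
  show ?thesis
    using X by (simp add: t_spacing_def spacing_stat_def c k1 k2 sig Let_def)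
qed

lemma measurable_ip_borel[measurable]: "ip n v \<in> borel_measurable (Pi\<^sub>M {..<n} (\<lambda>_. borel))"
  unfolding ip_def[abs_def] by measurable

lemma measurable_ip_self_borel[measurable]: "(\<lambda>z. ip n z z) \<in> borel_measurable (Pi\<^sub>M {..<n} (\<lambda>_. borel))"
  unfolding ip_def[abs_def] by measurable

lemma measurable_student_cdf[measurable]:
  assumes "\<nu> > 0" shows "student_cdf \<nu> \<in> borel_measurable borel"
  unfolding student_cdf_eq
  using positive_density_cdf(1)[OF measurable_student_density student_density_pos[OF assms]
      real_distribution_student[OF assms] student_def]
  by (rule borel_measurable_continuous_onI)

text \<open>
  The selected pair is a function of the finite set of maximising pairs, and this set takes finitely
  many values, each on a Borel set. Ties are therefore harmless, whatever the choice among them.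
\<close>

lemma measurable_t_spacing:
  assumes n: "n \<ge> 2" and X: "X \<in> carrier_mat n p" and p: "p \<ge> 1"
    and unit: "\<And>i. i < p \<Longrightarrow> l2_norm (col X i) = 1"
    and rk: "\<And>i. i < p \<Longrightarrow> vec_space.rank n (del_col X i) = n"
  shows "(\<lambda>v. t_spacing X (vec n v)) \<in> borel_measurable (Pi\<^sub>M {..<n} (\<lambda>_. borel))"
proof -
  let ?P = "Pi\<^sub>M {..<n} (\<lambda>_. borel :: real measure)" and ?C = "{..<p} \<times> {- 1, 1 :: real}"
  have [measurable]: "student_cdf (real n - 1) \<in> borel_measurable borel"
    using n by (intro measurable_student_cdf) simp
  have stat: "(\<lambda>v. spacing_stat n X v c) \<in> borel_measurable ?P" for c
    unfolding spacing_stat_def Let_def split_beta' by measurable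
  have max_in: "maximisers n X v \<in> Pow ?C" for v
    using X by (auto simp: maximisers_def)
  \<comment> \<open>Each value of \<open>maximisers n X\<close> is attained on a Boolean combination of closed half-spaces.\<close>
  have "maximisers n X \<in> ?P \<rightarrow>\<^sub>M count_space (Pow ?C)"
  proof (subst measurable_count_space_eq2)
    show "finite (Pow ?C)" by simp
    have "maximisers n X -` {S} \<inter> space ?P \<in> sets ?P" if S: "S \<in> Pow ?C" for S
    proof -
      define Q where "Q c v \<longleftrightarrow> (\<forall>j\<in>{..<p}. \<bar>ip n (xcol X j) v\<bar> \<le> snd c * ip n (xcol X (fst c)) v)" for c v
      have Q: "{v \<in> space ?P. Q c v} \<in> sets ?P" for c
        unfolding Q_def
        by (intro sets.sets_Collect_finite_All' borel_measurable_le borel_measurable_abs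
            borel_measurable_times borel_measurable_const measurable_ip_borel)
          (use p in \<open>auto simp: lessThan_empty_iff\<close>)
      have "maximisers n X v = {c \<in> ?C. Q c v}" for v
        using X by (auto simp: maximisers_def Q_def)
      moreover have "{c \<in> D. Q c v} = S \<longleftrightarrow> (\<forall>c\<in>D. if c \<in> S then Q c v else \<not> Q c v)"
        if "S \<subseteq> D" for D v
        using that by (auto split: if_splits)
      ultimately have iff: "maximisers n X v = S \<longleftrightarrow> (\<forall>c\<in>?C. if c \<in> S then Q c v else \<not> Q c v)" for v
        using S by (simp only: Pow_iff)
      have "maximisers n X -` {S} \<inter> space ?P = {v \<in> space ?P. maximisers n X v = S}"
        by blast
      also have "\<dots> = {v \<in> space ?P. \<forall>c\<in>?C. if c \<in> S then Q c v else \<not> Q c v}"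
        by (simp only: iff)
      also have "\<dots> \<in> sets ?P"
      proof (rule sets.sets_Collect_finite_All')
        fix c
        show "{v \<in> space ?P. if c \<in> S then Q c v else \<not> Q c v} \<in> sets ?P"
          using Q[of c] by (cases "c \<in> S") (auto intro: sets.sets_Collect_neg)
      qed (use p in \<open>auto simp: lessThan_empty_iff\<close>)
      finally show ?thesis .
    qed
    then show "maximisers n X \<in> space ?P \<rightarrow> Pow ?C \<and> (\<forall>S\<in>Pow ?C. maximisers n X -` {S} \<inter> space ?P \<in> sets ?P)"
      using max_in by blast
  qed
  then have "(\<lambda>v. spacing_stat n X v (SOME c. c \<in> maximisers n X v)) \<in> borel_measurable ?P"
    by (intro measurable_compose_countable'[of "Pow ?C" "\<lambda>S v. spacing_stat n X v (SOME c. c \<in> S)" ?P borel "maximisers n X"])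
      (auto intro: stat countable_finite)
  moreover have "t_spacing X (vec n v) = spacing_stat n X v (SOME c. c \<in> maximisers n X v)" for v
    using t_spacing_eq[OF X p unit rk, of v] by (simp add: lars_first_eq[OF X])
  ultimately show ?thesis by simp
qed

section \<open>Reduction to a standard normal vector\<close>

text \<open>
  A matrix \<open>a\<close> with \<open>a a\<^sup>T = c I\<close> has a transpose that preserves inner products up to the factor \<open>c\<close>.
\<close>

lemma ip_transport:
  assumes a: "\<And>l m. l < n \<Longrightarrow> m < n \<Longrightarrow> (\<Sum>k<n. a l k * a m k) = (if l = m then c else 0)"
  shows "ip n (\<lambda>k. \<Sum>l<n. x l * a l k) (\<lambda>k. \<Sum>m<n. y m * a m k) = c * ip n x y"
proof -
  have "ip n (\<lambda>k. \<Sum>l<n. x l * a l k) (\<lambda>k. \<Sum>m<n. y m * a m k) =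
      (\<Sum>k<n. \<Sum>l<n. \<Sum>m<n. x l * y m * (a l k * a m k))"
    by (simp add: ip_def sum_product mult_ac)
  also have "\<dots> = (\<Sum>l<n. \<Sum>k<n. \<Sum>m<n. x l * y m * (a l k * a m k))" by (rule sum.swap)
  also have "\<dots> = (\<Sum>l<n. \<Sum>m<n. \<Sum>k<n. x l * y m * (a l k * a m k))"
    by (intro sum.cong refl sum.swap)
  also have "\<dots> = (\<Sum>l<n. \<Sum>m<n. if m = l then c * (x l * y l) else 0)"
    by (intro sum.cong refl) (auto simp: sum_distrib_left[symmetric] a)
  also have "\<dots> = c * ip n x y"
    by (simp add: ip_def sum_distrib_left)
  finally show ?thesis .
qed

lemma ip_adjoint:
  "ip n x (\<lambda>l. \<Sum>k<n. a l k * z k) = ip n (\<lambda>k. \<Sum>l<n. x l * a l k) z"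
proof -
  have "ip n x (\<lambda>l. \<Sum>k<n. a l k * z k) = (\<Sum>l<n. \<Sum>k<n. x l * a l k * z k)"
    by (simp add: ip_def sum_distrib_left mult.assoc)
  also have "\<dots> = (\<Sum>k<n. \<Sum>l<n. x l * a l k * z k)" by (rule sum.swap)
  finally show ?thesis by (simp add: ip_def sum_distrib_right)
qed

text \<open>
  The vectors are padded with zeros, so that vectors with the same coordinates are the same
  function: columns that agree up to sign contribute a single pair of elements.
\<close>

definition signed_cols :: "nat \<Rightarrow> nat \<Rightarrow> (nat \<Rightarrow> nat \<Rightarrow> real) \<Rightarrow> (nat \<Rightarrow> real) set" where
  "signed_cols n p W = (\<lambda>(i, \<epsilon>). \<lambda>k. if k < n then \<epsilon> * W i k else 0) ` ({..<p} \<times> {- 1, 1})"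

lemma signed_colsE:
  assumes "w \<in> signed_cols n p W"
  obtains i \<epsilon> where "i < p" "\<epsilon> \<in> {- 1, 1}" "w = (\<lambda>k. if k < n then \<epsilon> * W i k else 0)"
proof -
  obtain c where c: "w = (\<lambda>(i, \<epsilon>). \<lambda>k. if k < n then \<epsilon> * W i k else 0) c" "c \<in> {..<p} \<times> {- 1, 1}"
    using assms unfolding signed_cols_def by (rule imageE)
  show thesis by (rule that[of "fst c" "snd c"]) (use c in \<open>auto simp: split_beta'\<close>)
qed

text \<open>
  Here \<open>y\<close> is the response and \<open>z\<close> the standard normal vector behind it, with \<open>W i\<close> the direction
  through which \<open>z\<close> determines the \<open>i\<close>-th correlation. The common factor \<open>\<sigma>\<close> cancels from both ratios.
  The two index sets of the second knot differ: a signed column equal to \<open>w\<close> that stems from another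
  index contributes the quotient \<open>0 / 0 = 0\<close>, while \<open>- w\<close>, which stems from the index \<open>i\<close> itself, contributes
  \<open>0\<close> to \<open>runner_up\<close>. Both maxima are nonnegative, so neither discrepancy changes the value.
\<close>

lemma spacing_stat_scale:
  fixes W :: "nat \<Rightarrow> nat \<Rightarrow> real"
  assumes p: "p \<ge> 2" and X: "dim_col X = p" and \<sigma>: "\<sigma> > 0"
    and unit: "\<And>i. i < p \<Longrightarrow> ip n (W i) (W i) = 1"
    and gram: "\<And>i j. i < p \<Longrightarrow> j < p \<Longrightarrow> ip n (xcol X i) (xcol X j) = ip n (W i) (W j)"
    and corr: "\<And>i. i < p \<Longrightarrow> ip n (xcol X i) y = \<sigma> * ip n (W i) z"
    and norm: "ip n y y = \<sigma>\<^sup>2 * ip n z z"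
    and c: "(i, \<epsilon>) \<in> maximisers n X y"
    and w: "w \<in> signed_cols n p W" and best: "\<And>v. v \<in> signed_cols n p W - {w} \<Longrightarrow> ip n v z < ip n w z"
  shows "spacing_stat n X y (i, \<epsilon>) =
    (1 - student_cdf (real n - 1) (sqrt (real n - 1) * ip n w z / perp n w z)) /
    (1 - student_cdf (real n - 1) (sqrt (real n - 1) * runner_up n (signed_cols n p W) w z / perp n w z))"
proof -
  let ?V = "signed_cols n p W"
  define S where "S c = (\<lambda>k. if k < n then snd c * W (fst c) k else 0)" for c :: "nat \<times> real"
  have V: "?V = S ` ({..<p} \<times> {- 1, 1})"
    by (simp add: signed_cols_def S_def split_beta')
  have fin: "finite ?V" by (simp add: V)
  have ipS: "ip n (S (j, \<delta>)) u = \<delta> * ip n (W j) u" for j \<delta> u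
    by (simp add: ip_def S_def sum_distrib_left mult.assoc)
  have ipSS: "ip n (S (j, \<delta>)) (S (k, \<eta>)) = \<delta> * \<eta> * ip n (W j) (W k)" for j \<delta> k \<eta>
    unfolding ipS using ipS[of k \<eta> "W j"] by (simp add: ip_commute)
  have i: "i < p" "\<epsilon> \<in> {- 1, 1}"
    and max: "\<And>j. j < p \<Longrightarrow> \<bar>ip n (xcol X j) y\<bar> \<le> \<epsilon> * ip n (xcol X i) y"
    using c X by (auto simp: maximisers_def)
  have \<epsilon>2: "\<epsilon> * \<epsilon> = 1" using i(2) by auto
  have S_le: "ip n v z \<le> ip n (S (i, \<epsilon>)) z" if v: "v \<in> ?V" for v
  proof -
    obtain j \<delta> where j: "j < p" "\<delta> \<in> {- 1, 1}" "v = S (j, \<delta>)" using v unfolding V by blast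
    have "\<sigma> * ip n v z = \<delta> * ip n (xcol X j) y"
      by (simp add: j(3) ipS corr[OF j(1)])
    also have "\<dots> \<le> \<bar>ip n (xcol X j) y\<bar>" using j(2) by auto
    also have "\<dots> \<le> \<epsilon> * ip n (xcol X i) y" by (rule max[OF j(1)])
    also have "\<dots> = \<sigma> * ip n (S (i, \<epsilon>)) z" by (simp add: ipS corr[OF i(1)])
    finally have "\<sigma> * ip n v z \<le> \<sigma> * ip n (S (i, \<epsilon>)) z" .
    then show ?thesis using \<sigma> by simp
  qed
  have w_eq: "w = S (i, \<epsilon>)"
  proof (rule ccontr)
    assume "w \<noteq> S (i, \<epsilon>)"
    then have "S (i, \<epsilon>) \<in> ?V - {w}" using i unfolding V by auto
    then show False using best S_le[OF w] by fastforce
  qed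
  have ww: "ip n w w = 1" unfolding w_eq ipSS by (simp add: unit[OF i(1)] \<epsilon>2)
  let ?U = "\<lambda>j. ip n (xcol X j) y" and ?R = "\<lambda>j. ip n (xcol X j) (xcol X i)"
  have k1: "\<epsilon> * ?U i = \<sigma> * ip n w z"
    by (simp add: corr[OF i(1)] w_eq ipS)
  have s: "sqrt (ip n y y - (?U i)\<^sup>2) = \<sigma> * perp n w z"
  proof -
    have "(?U i)\<^sup>2 = (\<epsilon> * ?U i)\<^sup>2" using i(2) by auto
    then have "ip n y y - (?U i)\<^sup>2 = \<sigma>\<^sup>2 * (ip n z z - (ip n w z)\<^sup>2)"
      unfolding k1 norm by (simp add: power_mult_distrib right_diff_distrib)
    then show ?thesis using \<sigma> by (simp add: perp_def real_sqrt_mult)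
  qed
  define q where "q v = (ip n v z - ip n v w * ip n w z) / (1 - ip n v w)" for v
  have q: "\<sigma> * q (S (j, \<delta>)) = (\<delta> * ?U j - \<delta> * ?R j * ?U i) / (1 - \<delta> * \<epsilon> * ?R j)" if "j < p" for j \<delta>
    unfolding q_def w_eq unfolding ipSS unfolding ipS gram[OF that i(1)] corr[OF that] corr[OF i(1)]
    using \<epsilon>2 by (simp add: field_simps)
  have R_le: "\<bar>?R j\<bar> \<le> 1" if "j < p" for j
  proof -
    have "(ip n (W i) (W j))\<^sup>2 \<le> 1" using ip_square_le[OF unit[OF i(1)], of "W j"] unit[OF that] by simp
    then show ?thesis unfolding gram[OF that i(1)] by (simp add: abs_square_le_1 ip_commute)
  qed
  have q_self: "q (S (i, \<delta>)) = 0" if "\<delta> \<in> {- 1, 1}" for \<delta>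
    using q[OF i(1), of \<delta>] \<sigma> by (simp add: gram[OF i(1) i(1)] unit[OF i(1)])
  \<comment> \<open>The quotient at \<open>w\<close> itself has denominator \<open>0\<close>, hence the value \<open>0\<close> by convention.\<close>
  have q_w: "q w = 0" by (simp add: q_def ww)
  let ?k = "Max ((\<lambda>j. max ((?U j - ?R j * ?U i) / (1 - \<epsilon> * ?R j))
                           ((- ?U j + ?R j * ?U i) / (1 + \<epsilon> * ?R j))) ` ({..<p} - {i}))"
  have k_eq: "?k = Max ((\<lambda>j. \<sigma> * max (q (S (j, 1))) (q (S (j, - 1)))) ` ({..<p} - {i}))"
    using \<sigma> by (intro arg_cong[where f = Max] image_cong refl) (simp add: max_mult_distrib_left q)
  have ne: "{..<p} - {i} \<noteq> {}"
  proof -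
    have "(if i = 0 then 1 else 0) \<in> {..<p} - {i}" using p by auto
    then show ?thesis by blast
  qed
  have neg: "S (i, - \<epsilon>) \<in> ?V - {w}"
  proof -
    have "ip n (S (i, - \<epsilon>)) w = - 1" unfolding w_eq ipSS using unit[OF i(1)] \<epsilon>2 by simp
    then have "S (i, - \<epsilon>) \<noteq> w" using ww by auto
    then show ?thesis using i unfolding V by auto
  qed
  have k2: "?k = \<sigma> * runner_up n ?V w z"
  proof (rule antisym)
    have r_ge: "q v \<le> runner_up n ?V w z" if "v \<in> ?V - {w}" for v
      unfolding runner_up_def q_def using that fin by (intro Max_ge) auto
    have "0 \<le> runner_up n ?V w z" using r_ge[OF neg] q_self[of "- \<epsilon>"] i(2) by auto
    then have "q v \<le> runner_up n ?V w z" if "v \<in> ?V" for v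
      using r_ge[of v] q_w that by (cases "v = w") auto
    then have "max (q (S (j, 1))) (q (S (j, - 1))) \<le> runner_up n ?V w z" if "j < p" for j
      using that by (auto simp: V)
    then show "?k \<le> \<sigma> * runner_up n ?V w z"
      unfolding k_eq using ne \<sigma> by (subst Max_le_iff) auto
    have k_ge: "\<sigma> * q (S (j, \<delta>)) \<le> ?k" if "j < p" "j \<noteq> i" "\<delta> \<in> {- 1, 1}" for j \<delta>
    proof -
      have "\<sigma> * q (S (j, \<delta>)) \<le> \<sigma> * max (q (S (j, 1))) (q (S (j, - 1)))"
        using that(3) \<sigma> by auto
      also have "\<dots> \<le> ?k" unfolding k_eq using that by (intro Max_ge) auto
      finally show ?thesis .
    qed
    \<comment> \<open>For any other index the two quotients have numerators of opposite sign.\<close>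
    have k0: "0 \<le> ?k"
    proof -
      obtain j where j: "j < p" "j \<noteq> i" using ne by auto
      have d: "0 \<le> 1 - \<delta> * \<epsilon> * ?R j" if "\<delta> \<in> {- 1, 1}" for \<delta>
        using R_le[OF j(1)] i(2) that by auto
      have "0 \<le> \<sigma> * q (S (j, 1)) \<or> 0 \<le> \<sigma> * q (S (j, - 1))"
      proof (cases "?U j - ?R j * ?U i \<ge> 0")
        case True
        then show ?thesis using d[of 1] unfolding q[OF j(1)] by (auto intro!: divide_nonneg_nonneg)
      next
        case False
        then show ?thesis using d[of "- 1"] unfolding q[OF j(1)] by (auto intro!: divide_nonneg_nonneg)
      qed
      then show ?thesis using k_ge[OF j, of 1] k_ge[OF j, of "- 1"] by auto
    qed
    have "\<sigma> * q v \<le> ?k" if v: "v \<in> ?V" for v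
    proof -
      obtain j \<delta> where j: "j < p" "\<delta> \<in> {- 1, 1}" "v = S (j, \<delta>)" using v unfolding V by blast
      show ?thesis
        using k_ge[OF j(1) _ j(2)] k0 q_self[OF j(2)] j(3) by (cases "j = i") auto
    qed
    moreover have "runner_up n ?V w z \<in> q ` (?V - {w})"
      unfolding runner_up_def q_def using fin neg by (intro Max_in) auto
    ultimately show "\<sigma> * runner_up n ?V w z \<le> ?k" by auto
  qed
  have cancel: "\<sigma> * a / (\<sigma> * b / d) = d * a / b" for a b d :: real
    using \<sigma> by (simp add: field_simps)
  show ?thesis
    unfolding spacing_stat_def Let_def split X k1 s k2 cancel ..
qed

lemma mat_square_orthogonal:
  assumes A: "A \<in> carrier_mat n n" and AA: "A * transpose_mat A = c \<cdot>\<^sub>m 1\<^sub>m n" and c: "(c :: real) \<noteq> 0"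
  shows "transpose_mat A * A = c \<cdot>\<^sub>m 1\<^sub>m n"
proof -
  let ?B = "(1 / c) \<cdot>\<^sub>m transpose_mat A"
  have B: "?B \<in> carrier_mat n n" using A by simp
  have "A * ?B = (1 / c) \<cdot>\<^sub>m (A * transpose_mat A)"
    using A by (intro mult_smult_distrib) auto
  also have "\<dots> = 1\<^sub>m n" unfolding AA using c by (intro eq_matI) auto
  finally have "?B * A = 1\<^sub>m n" by (rule mat_mult_left_right_inverse[OF A B])
  moreover have "?B * A = (1 / c) \<cdot>\<^sub>m (transpose_mat A * A)"
    using A by (intro mult_smult_assoc_mat) auto
  ultimately have "c \<cdot>\<^sub>m ((1 / c) \<cdot>\<^sub>m (transpose_mat A * A)) = c \<cdot>\<^sub>m 1\<^sub>m n" by simp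
  moreover have "c \<cdot>\<^sub>m ((1 / c) \<cdot>\<^sub>m (transpose_mat A * A)) = transpose_mat A * A"
    using A c by (intro eq_matI) auto
  ultimately show ?thesis by simp
qed

theorem theorem3:
  fixes M :: "'a measure" and n p :: nat and X :: "real mat"
    and \<beta> :: "real vec" and \<xi> Y :: "'a \<Rightarrow> real vec"
    and \<Sigma> :: "real mat" and \<sigma> :: real
  assumes "prob_space M"
    and "n \<ge> 2" and "p \<ge> 1"
    and "X \<in> carrier_mat n p" and "\<beta> \<in> carrier_vec p"
    and "multivariate_normal M n \<xi> (0\<^sub>v n) \<Sigma>"
    and "\<And>\<omega>. \<omega> \<in> space M \<Longrightarrow> Y \<omega> = X *\<^sub>v \<beta> + \<xi> \<omega>"
    and "\<Sigma> = \<sigma>\<^sup>2 \<cdot>\<^sub>m 1\<^sub>m n" and "\<sigma> > 0"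
    and "\<And>i. i < p \<Longrightarrow> l2_norm (col X i) = 1"
    and "\<And>i j. i < p \<Longrightarrow> j < p \<Longrightarrow> i \<noteq> j \<Longrightarrow> col X i \<noteq> col X j"
    and "\<And>i. i < p \<Longrightarrow> vec_space.rank n (del_col X i) = n"
    and "\<beta> \<in> mat_kernel X"
  shows "distributed M lborel (\<lambda>\<omega>. t_spacing X (Y \<omega>))
           (\<lambda>x. indicator {0..1} x / measure lborel {0..1::real})"
proof -
  note n = assms(2) and p1 = assms(3) and X = assms(4) and unitX = assms(10) and rk = assms(12)
  interpret prob_space M by (rule assms(1))
  let ?P = "Pi\<^sub>M {..<n} (\<lambda>_. borel :: real measure)" and ?\<Gamma> = "gaussian_coords n"
  \<comment> \<open>A second column exists because \<open>X\<close> without its first column still has rank \<open>n > 0\<close>.\<close>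
  have p: "p \<ge> 2"
  proof (rule ccontr)
    assume "\<not> p \<ge> 2"
    then have "p = 1" using p1 by simp
    then have "del_col X 0 \<in> carrier_mat n 0" using X by (simp add: del_col_def)
    then have "vec_space.rank n (del_col X 0) \<le> 0" by (rule vec_space.rank_le_nc)
    then show False using rk[of 0] p1 n by simp
  qed
  obtain A where A: "A \<in> carrier_mat n n" and AA: "A * transpose_mat A = \<sigma>\<^sup>2 \<cdot>\<^sub>m 1\<^sub>m n"
    and law: "distr M ?P (\<lambda>\<omega>. coords n (\<xi> \<omega>)) = distr ?\<Gamma> ?P (\<lambda>z. coords n (0\<^sub>v n + A *\<^sub>v vec n z))"
    and meas\<xi>[measurable]: "(\<lambda>\<omega>. coords n (\<xi> \<omega>)) \<in> M \<rightarrow>\<^sub>M ?P"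
    and \<xi>: "\<And>\<omega>. \<omega> \<in> space M \<Longrightarrow> \<xi> \<omega> \<in> carrier_vec n"
    using assms(6) unfolding multivariate_normal_def assms(8) gaussian_coords_def by blast
  have AtA: "transpose_mat A * A = \<sigma>\<^sup>2 \<cdot>\<^sub>m 1\<^sub>m n"
    using mat_square_orthogonal[OF A AA] assms(9) by simp
  define t where "t v = t_spacing X (vec n v)" for v
  have t[measurable]: "t \<in> borel_measurable ?P"
    unfolding t_def[abs_def] by (rule measurable_t_spacing[OF n X p1 unitX rk])
  have Y_eq: "t_spacing X (Y \<omega>) = t (coords n (\<xi> \<omega>))" if \<omega>: "\<omega> \<in> space M" for \<omega>
  proof -
    have "X *\<^sub>v \<beta> = 0\<^sub>v n" using mat_kernelD[OF X assms(13)] by simp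
    then have "Y \<omega> = \<xi> \<omega>" using assms(7)[OF \<omega>] \<xi>[OF \<omega>] by simp
    moreover have "vec n (coords n (\<xi> \<omega>)) = \<xi> \<omega>"
      using \<xi>[OF \<omega>] by (intro eq_vecI) (auto simp: coords_def)
    ultimately show ?thesis by (simp add: t_def)
  qed
  define a where "a l k = A $$ (l, k)" for l k
  define g where "g z = (\<lambda>l\<in>{..<n}. \<Sum>k<n. a l k * z k)" for z
  have g_eq: "coords n (0\<^sub>v n + A *\<^sub>v vec n z) = g z" for z
    using A by (auto simp: coords_def g_def a_def scalar_prod_def lessThan_atLeast0 intro!: restrict_ext)
  have g[measurable]: "g \<in> lebesgue_coords n \<rightarrow>\<^sub>M ?P"
    unfolding g_def[abs_def] by measurable
  have row_orth: "(\<Sum>k<n. a l k * a m k) = (if l = m then \<sigma>\<^sup>2 else 0)" if "l < n" "m < n" for l m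
    using arg_cong[OF AA, of "\<lambda>M. M $$ (l, m)"] A that
    by (simp add: a_def scalar_prod_def lessThan_atLeast0)
  have col_orth: "(\<Sum>l<n. a l k * a l m) = (if k = m then \<sigma>\<^sup>2 else 0)" if "k < n" "m < n" for k m
    using arg_cong[OF AtA, of "\<lambda>M. M $$ (k, m)"] A that
    by (simp add: a_def scalar_prod_def lessThan_atLeast0)
  define W where "W j = (\<lambda>k. (\<Sum>l<n. xcol X j l * a l k) / \<sigma>)" for j
  \<comment> \<open>\<open>A A\<^sup>T = \<sigma>\<^sup>2 I\<close> preserves the Gram matrix of the columns; \<open>A\<^sup>T A = \<sigma>\<^sup>2 I\<close> gives the norm of the response.\<close>
  have ip_W: "ip n (W i) (W j) = ip n (xcol X i) (xcol X j)" for i j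
  proof -
    have "ip n (W i) (W j) = ip n (\<lambda>k. \<Sum>l<n. xcol X i l * a l k) (\<lambda>k. \<Sum>l<n. xcol X j l * a l k) / \<sigma>\<^sup>2"
      unfolding ip_def W_def power2_eq_square times_divide_times_eq sum_divide_distrib[of _ "{..<n}", symmetric] ..
    also have "\<dots> = ip n (xcol X i) (xcol X j)"
      using assms(9) by (simp add: ip_transport[of n a "\<sigma>\<^sup>2", OF row_orth])
    finally show ?thesis .
  qed
  have unitW: "ip n (W i) (W i) = 1" if "i < p" for i
  proof -
    have "ip n (xcol X i) (xcol X i) = col X i \<bullet> col X i"
      using X that by (simp add: ip_def xcol_def scalar_prod_def lessThan_atLeast0)
    then show ?thesis using unitX[OF that] by (simp add: ip_W l2_norm_def)
  qed
  have ip_g: "ip n x (g z) = ip n (\<lambda>k. \<Sum>l<n. x l * a l k) z" for x z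
    unfolding ip_adjoint[symmetric] by (simp add: ip_def g_def)
  have corr_g: "ip n (xcol X i) (g z) = \<sigma> * ip n (W i) z" for i z
    using assms(9) by (simp add: ip_g) (simp add: ip_def W_def sum_distrib_left)
  have norm_g: "ip n (g z) (g z) = \<sigma>\<^sup>2 * ip n z z" for z
  proof -
    have "ip n (g z) (g z) = ip n (\<lambda>l. \<Sum>k<n. z k * a l k) (\<lambda>l. \<Sum>k<n. z k * a l k)"
      by (simp add: ip_def g_def mult.commute)
    also have "\<dots> = \<sigma>\<^sup>2 * ip n z z"
      by (rule ip_transport[of n "\<lambda>k l. a l k", OF col_orth])
    finally show ?thesis .
  qed
  let ?V = "signed_cols n p W"
  have V_unit: "ip n w w = 1" if w: "w \<in> ?V" for w
  proof -
    obtain i \<epsilon> where i: "i < p" "\<epsilon> \<in> {- 1, 1 :: real}" "w = (\<lambda>k. if k < n then \<epsilon> * W i k else 0)"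
      using w by (rule signed_colsE)
    have "ip n w w = \<epsilon> * \<epsilon> * ip n (W i) (W i)"
      by (simp add: ip_def i(3) sum_distrib_left mult_ac)
    then show ?thesis using i(2) unitW[OF i(1)] by auto
  qed
  have V_less: "ip n v w < 1" if vw: "v \<in> ?V" "w \<in> ?V" "v \<noteq> w" for v w
  proof (rule ccontr)
    assume "\<not> ip n v w < 1"
    moreover have "(\<Sum>k<n. (v k - w k) * (v k - w k)) = ip n v v + ip n w w - 2 * ip n v w"
      by (simp add: ip_def algebra_simps sum.distrib sum_subtractf sum_distrib_left)
    moreover have "0 \<le> (\<Sum>k<n. (v k - w k) * (v k - w k))" by (intro sum_nonneg) simp
    ultimately have "(\<Sum>k<n. (v k - w k) * (v k - w k)) = 0" using vw V_unit by simp
    then have "\<forall>k<n. v k = w k" by (subst (asm) sum_nonneg_eq_0_iff) auto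
    moreover have "v k = w k" if "\<not> k < n" for k
      using vw(1,2) that by (auto simp: signed_cols_def)
    ultimately show False using vw(3) by blast
  qed
  have V_others: "?V - {w} \<noteq> {}" if w: "w \<in> ?V" for w
  proof -
    obtain i \<epsilon> where i: "i < p" "\<epsilon> \<in> {- 1, 1 :: real}" "w = (\<lambda>k. if k < n then \<epsilon> * W i k else 0)"
      using w by (rule signed_colsE)
    let ?m = "\<lambda>k. if k < n then - \<epsilon> * W i k else 0"
    have "?m \<in> ?V"
      unfolding signed_cols_def using i by (intro image_eqI[of _ _ "(i, - \<epsilon>)"]) auto
    moreover have "ip n ?m w = - ip n w w"
      by (simp add: ip_def i(3) sum_negf[symmetric])
    then have "?m \<noteq> w" using V_unit[OF w] by auto
    ultimately show ?thesis by blast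
  qed
  have uniform: "measure ?\<Gamma> {z \<in> space ?\<Gamma>. t (g z) \<le> s} = s" if s: "0 \<le> s" "s \<le> 1" for s
  proof (rule spacing_uniform[OF n _ _ V_others V_unit V_less _ _ s])
    show "finite ?V" by (simp add: signed_cols_def)
    show "?V \<noteq> {}" using p by (auto simp: signed_cols_def lessThan_empty_iff)
    show "(\<lambda>z. t (g z)) \<in> borel_measurable (lebesgue_coords n)" by measurable
    fix w z assume w: "w \<in> ?V" and best: "\<And>v. v \<in> ?V - {w} \<Longrightarrow> ip n v z < ip n w z"
    obtain i \<epsilon> where c: "lars_first X (vec n (g z)) = (i, \<epsilon>)" by (metis surj_pair)
    have max: "(i, \<epsilon>) \<in> maximisers n X (g z)"
      using lars_first_maximiser[OF X p1, of "g z"] by (simp add: c)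
    have "t (g z) = spacing_stat n X (g z) (i, \<epsilon>)"
      using t_spacing_eq[OF X p1 unitX rk, of "g z"] by (simp only: t_def c)
    then show "t (g z) = (1 - student_cdf (real n - 1) (sqrt (real n - 1) * ip n w z / perp n w z)) /
        (1 - student_cdf (real n - 1) (sqrt (real n - 1) * runner_up n ?V w z / perp n w z))"
      using spacing_stat_scale[OF p _ assms(9) unitW _ corr_g norm_g max w best] X
      by (simp add: ip_W)
  qed
  have [measurable]: "(\<lambda>\<omega>. t (coords n (\<xi> \<omega>))) \<in> borel_measurable M" by measurable
  have meas: "(\<lambda>\<omega>. t_spacing X (Y \<omega>)) \<in> borel_measurable M"
    by (subst measurable_cong[OF Y_eq]) measurable
  have "prob {\<omega> \<in> space M. t_spacing X (Y \<omega>) \<le> s} = s" if s: "0 \<le> s" "s \<le> 1" for s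
  proof -
    have S: "{v \<in> space ?P. t v \<le> s} \<in> sets ?P" by measurable
    have g': "g \<in> ?\<Gamma> \<rightarrow>\<^sub>M ?P" by measurable
    have "prob {\<omega> \<in> space M. t_spacing X (Y \<omega>) \<le> s} =
        prob ((\<lambda>\<omega>. coords n (\<xi> \<omega>)) -` {v \<in> space ?P. t v \<le> s} \<inter> space M)"
      using measurable_space[OF meas\<xi>] Y_eq by (intro arg_cong[where f = prob]) auto
    also have "\<dots> = measure (distr M ?P (\<lambda>\<omega>. coords n (\<xi> \<omega>))) {v \<in> space ?P. t v \<le> s}"
      by (rule measure_distr[OF meas\<xi> S, symmetric])
    also have "\<dots> = measure (distr ?\<Gamma> ?P g) {v \<in> space ?P. t v \<le> s}"
      unfolding law g_eq ..
    also have "\<dots> = measure ?\<Gamma> (g -` {v \<in> space ?P. t v \<le> s} \<inter> space ?\<Gamma>)"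
      by (rule measure_distr[OF g' S])
    also have "g -` {v \<in> space ?P. t v \<le> s} \<inter> space ?\<Gamma> = {z \<in> space ?\<Gamma>. t (g z) \<le> s}"
      using measurable_space[OF g'] by auto
    also have "measure ?\<Gamma> \<dots> = s" by (rule uniform[OF s])
    finally show ?thesis .
  qed
  then show ?thesis
    unfolding uniform_distributed_iff using meas by auto
qed

end
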